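(* There exist parallel poly-pushdown ($\mathcal P$) groups which are not finitely presented.
   Context: **Languages.** For a finite alphabet $A$, $A^*$ is the free monoid on $A$ (words), $\epsilon$ is the empty word, and a language is a subset of $A^*$. **Deterministic pushdown automata.** A deterministic pushdown automaton is a 7-tuple $M=(S,A,B,\tau,s_0,Z_0,Y)$ with $S$ a finite set of states, $A$ a finite input alphabet, $B$ a finite stack alphabet, $s_0\in S$ the start state, $Z_0\in B$ the start symbol, $Y\subseteq S$ the final states, and $\tau:\Sigma\to S\times B^*$ a map with $\Sigma\subseteq (A\cup\{\epsilon\})\times B\times S$ such that for every $(b,s)\in B\times S$ either $(\epsilon,b,s)\in\Sigma$ and $(a,b,s)\notin\Sigma$ for all $a\in A$, or $(\epsilon,b,s)\notin\Sigma$ and $(a,b,s)\in\Sigma$ for all $a\in A$. An instantaneous description is a triple $(u,z,s)\in A^*\times B^*\times S$ (unread input, stack with top at the right end, state). $M$ makes the transition $(av,yb,s)\to(v,y\alpha,t)$ if $a\in A\cup\{\epsilon\}$, $b\in B$, $(a,b,s)\in \Sigma$ and $\tau(a,b,s)=(t,\alpha)$; $\to^*$ is the reflexive transitive closure. $M$ accepts $w$ by final state if $(w,Z_0,s_0)\to^*(\epsilon,z,s)$ for some $z\in B^*$, $s\in Y$; it accepts $w$ by empty stack if $(w,Z_0,s_0)\to^*(\epsilon,\epsilon,s)$ for some $s\in S$. A language is the language of a deterministic pushdown automaton if it is the set of words accepted by some such $M$ in either one of these two modes. **$\mathcal P$ languages.** $L\subseteq A^*$ is parallel poly-pushdown ($\mathcal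 P$) if it is an intersection of finitely many languages over $A$ of deterministic pushdown automata. **Two-tape version.** Let $\$$ be a symbol not in $A$, and let $(A\cup\{\$\})^\sharp$, $(A\cup\{\$\})^\flat$ be two disjoint copies of $A\cup\{\$\}$, with induced maps on words $u\mapsto u^\sharp$, $v\mapsto v^\flat$. A shuffle $\sigma(u,v)$ of words $u,v$ is a word $u_1^\sharp v_1^\flat\cdots u_k^\sharp v_k^\flat$ with $u=u_1\cdots u_k$, $v=v_1\cdots v_k$, $u_i\ne\epsilon$ for $i>1$, $v_j\neq\epsilon$ for $j<k$. An asynchronous two-tape pushdown automaton over $A$ is a deterministic pushdown automaton $T$ with input alphabet $(A\cup\{\$\})^\sharp\sqcup (A\cup\{\$\})^\flat$ whose states are partitioned into two sets $S_\sharp,S_\flat$. A pair $(u,v)\in A^*\times A^*$ is accepted by $T$ if some shuffle $\sigma(u\$,v\$)$ is accepted by $T$ and, while reading it, $T$ reads letters of $(A\cup\{\$\})^\sharp$ only in states of $S_\sharp$ and letters of $(A\cup\{\$\})^\flat$ only in states of $S_\flat$. The language of $T$ is the set of accepted pairs. A subset of $A^*\times A^*$ is AT$\mathcal P$ (asynchronous two-tape parallel poly-pushdown) if it is the intersection of the languages of finitely many asynchronous two-tape pushdown automata over $A$. **$\mathcal P$ groups.** Let $G$ be a group and $A$ a finite set with a map $A\to G$ such that the induced monoid homomorphism $A^*\to G$, $w\mapsto\overline w$, is surjective. A language $L\subseteq A^*$ is a parallel poly-pushdown structure for $G$ if (1) $w\mapsto \overline w$ restricts to a bijection $L\to G$;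 (2) $L$ is $\mathcal P$; (3) for each $a\in A$ the set $\{(w,w')\in L\times L: \overline{w'}=\overline{wa}\}$ is AT$\mathcal P$. $G$ is parallel poly-pushdown (a $\mathcal P$ group) if it has such a structure for some such $A$. *)

theory Defs
  imports "HOL-Algebra.Group"
begin

section \<open>Deterministic pushdown automata\<close>

text \<open>
  The transition map is a partial function with domain \<open>\<Sigma>\<close>; the symbol \<open>None\<close> in its first
  argument stands for the empty word.
\<close>

record ('s, 'a, 'b) dpda =
  states :: "'s set"
  input_alph :: "'a set"
  stack_alph :: "'b set"
  delta :: "'a option \<times> 'b \<times> 's \<rightharpoonup> 's \<times> 'b list"
  start_state :: 's
  start_symbol :: 'b
  final_states :: "'s set"

definition is_dpda :: "('s, 'a, 'b) dpda \<Rightarrow> bool" where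
  "is_dpda M \<longleftrightarrow>
     finite (states M) \<and> finite (input_alph M) \<and> finite (stack_alph M) \<and>
     start_state M \<in> states M \<and> start_symbol M \<in> stack_alph M \<and> final_states M \<subseteq> states M \<and>
     dom (delta M) \<subseteq> insert None (Some ` input_alph M) \<times> stack_alph M \<times> states M \<and>
     ran (delta M) \<subseteq> states M \<times> lists (stack_alph M) \<and>
     (\<forall>b \<in> stack_alph M. \<forall>s \<in> states M.
        ((None, b, s) \<in> dom (delta M) \<and> (\<forall>a \<in> input_alph M. (Some a, b, s) \<notin> dom (delta M))) \<or>
        ((None, b, s) \<notin> dom (delta M) \<and> (\<forall>a \<in> input_alph M. (Some a, b, s) \<in> dom (delta M))))"

text \<open>Instantaneous descriptions: unread input, stack (its top is the last element), state.\<close>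

type_synonym ('s, 'a, 'b) inst_desc = "'a list \<times> 'b list \<times> 's"

inductive dpda_step ::
  "('s, 'a, 'b) dpda \<Rightarrow> ('s, 'a, 'b) inst_desc \<Rightarrow> ('s, 'a, 'b) inst_desc \<Rightarrow> bool"
  for M where
  read: "delta M (Some a, b, s) = Some (t, \<alpha>) \<Longrightarrow> dpda_step M (a # v, y @ [b], s) (v, y @ \<alpha>, t)"
| eps: "delta M (None, b, s) = Some (t, \<alpha>) \<Longrightarrow> dpda_step M (v, y @ [b], s) (v, y @ \<alpha>, t)"

datatype acc_mode = Final_State | Empty_Stack

fun accepting :: "('s, 'a, 'b) dpda \<Rightarrow> acc_mode \<Rightarrow> ('s, 'a, 'b) inst_desc \<Rightarrow> bool" where
  "accepting M Final_State (w, z, s) \<longleftrightarrow> w = [] \<and> s \<in> final_states M"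
| "accepting M Empty_Stack (w, z, s) \<longleftrightarrow> w = [] \<and> z = []"

definition dpda_lang :: "('s, 'a, 'b) dpda \<Rightarrow> acc_mode \<Rightarrow> 'a list set" where
  "dpda_lang M m = {w \<in> lists (input_alph M).
     \<exists>d. (dpda_step M)\<^sup>*\<^sup>* (w, [start_symbol M], start_state M) d \<and> accepting M m d}"

text \<open>
  States and stack symbols are taken from \<^typ>\<open>nat\<close>; since they form finite sets, this is only a
  choice of names.
\<close>

definition is_dpda_language :: "'a set \<Rightarrow> 'a list set \<Rightarrow> bool" where
  "is_dpda_language A L \<longleftrightarrow>
     (\<exists>(M :: (nat, 'a, nat) dpda) m. is_dpda M \<and> input_alph M = A \<and> L = dpda_lang M m)"

definition parallel_poly_pushdown_language :: "'a set \<Rightarrow> 'a list set \<Rightarrow> bool" where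
  "parallel_poly_pushdown_language A L \<longleftrightarrow>
     (\<exists>F. finite F \<and> F \<noteq> {} \<and> (\<forall>K \<in> F. is_dpda_language A K) \<and> L = \<Inter>F)"


section \<open>Asynchronous two-tape pushdown automata\<close>

text \<open>
  In \<^typ>\<open>'a option + 'a option\<close>, \<open>None\<close> is the end marker $, and \<open>Inl\<close>, \<open>Inr\<close> are the
  sharp and the flat copy.
\<close>

definition two_tape_alph :: "'a set \<Rightarrow> ('a option + 'a option) set" where
  "two_tape_alph A = insert None (Some ` A) <+> insert None (Some ` A)"

definition end_marked :: "'a list \<Rightarrow> 'a option list" where
  "end_marked u = map Some u @ [None]"

definition is_shuffle :: "'c list \<Rightarrow> 'c list \<Rightarrow> ('c + 'c) list \<Rightarrow> bool" where
  "is_shuffle u v w \<longleftrightarrow>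
     (\<exists>us vs. length us = length vs \<and> u = concat us \<and> v = concat vs \<and>
        [] \<notin> set (tl us) \<and> [] \<notin> set (butlast vs) \<and>
        w = concat (map2 (\<lambda>x y. map Inl x @ map Inr y) us vs))"

lemma append_in_shuffles_left: "zs \<in> shuffles xs ys \<Longrightarrow> us @ zs \<in> shuffles (us @ xs) ys"
  by (induction us) (auto intro: Cons_in_shuffles_leftI)

lemma append_in_shuffles_right: "zs \<in> shuffles xs ys \<Longrightarrow> us @ zs \<in> shuffles xs (us @ ys)"
  by (induction us) (auto intro: Cons_in_shuffles_rightI)

lemma is_shuffle_if_in_shuffles:
  "w \<in> shuffles (map Inl u) (map Inr v) \<Longrightarrow> is_shuffle u v w"
proof (induction w arbitrary: u v)
  case Nil
  then show ?case unfolding is_shuffle_def by (intro exI[of _ "[]"]) auto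
next
  case (Cons c w)
  consider x u' where "u = x # u'" "c = Inl x" "w \<in> shuffles (map Inl u') (map Inr v)"
    | y v' where "v = y # v'" "c = Inr y" "w \<in> shuffles (map Inl u) (map Inr v')"
    using Cons.prems by (cases u; cases v) (auto simp: Cons_in_shuffles_iff)
  then show ?case
  proof cases
    case (1 x u')
    then obtain us vs where *: "length us = length vs" "u' = concat us" "v = concat vs"
        "[] \<notin> set (tl us)" "[] \<notin> set (butlast vs)"
        "w = concat (map2 (\<lambda>x y. map Inl x @ map Inr y) us vs)"
      using Cons.IH unfolding is_shuffle_def by blast
    show ?thesis
    proof (cases us)
      case Nil
      with * 1 show ?thesis unfolding is_shuffle_def
        by (intro exI[of _ "[[x]]"] exI[of _ "[[]]"]) auto
    next
      case (Cons u1 us')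
      with * 1 show ?thesis unfolding is_shuffle_def
        by (intro exI[of _ "(x # u1) # us'"] exI[of _ vs]) (cases vs; auto)
    qed
  next
    case (2 y v')
    then obtain us vs where *: "length us = length vs" "u = concat us" "v' = concat vs"
        "[] \<notin> set (tl us)" "[] \<notin> set (butlast vs)"
        "w = concat (map2 (\<lambda>x y. map Inl x @ map Inr y) us vs)"
      using Cons.IH unfolding is_shuffle_def by blast
    show ?thesis
    proof (cases us)
      case Nil
      with * 2 show ?thesis unfolding is_shuffle_def
        by (intro exI[of _ "[[]]"] exI[of _ "[[y]]"]) auto
    next
      case (Cons u1 us')
      then obtain v1 vs' where vs: "vs = v1 # vs'" using * by (cases vs) auto
      show ?thesis
      proof (cases "u1 = []")
        case True
        with * 2 Cons vs show ?thesis unfolding is_shuffle_def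
          by (intro exI[of _ us] exI[of _ "(y # v1) # vs'"]) (auto split: if_splits)
      next
        case False
        with * 2 Cons vs show ?thesis unfolding is_shuffle_def
          by (intro exI[of _ "[] # us"] exI[of _ "[y] # vs"]) auto
      qed
    qed
  qed
qed

lemma is_shuffle_iff: "is_shuffle u v w \<longleftrightarrow> w \<in> shuffles (map Inl u) (map Inr v)"
proof
  assume "is_shuffle u v w"
  then obtain us vs where *: "length us = length vs" "u = concat us" "v = concat vs"
      "w = concat (map2 (\<lambda>x y. map Inl x @ map Inr y) us vs)"
    unfolding is_shuffle_def by blast
  from *(1) have "concat (map2 (\<lambda>x y. map Inl x @ map Inr y) us vs)
      \<in> shuffles (map Inl (concat us)) (map Inr (concat vs))"
    by (induction us vs rule: list_induct2)
      (auto intro: append_in_shuffles_left append_in_shuffles_right)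
  with * show "w \<in> shuffles (map Inl u) (map Inr v)" by simp
qed (rule is_shuffle_if_in_shuffles)

definition is_two_tape_pda ::
  "'a set \<Rightarrow> ('s, 'a option + 'a option, 'b) dpda \<Rightarrow> 's set \<Rightarrow> 's set \<Rightarrow> bool" where
  "is_two_tape_pda A T S\<^sub>1 S\<^sub>2 \<longleftrightarrow>
     is_dpda T \<and> input_alph T = two_tape_alph A \<and> states T = S\<^sub>1 \<union> S\<^sub>2 \<and> S\<^sub>1 \<inter> S\<^sub>2 = {}"

text \<open>
  Transitions in which a letter of the sharp (flat) alphabet is read only in a state of \<open>S\<^sub>1\<close>
  (\<open>S\<^sub>2\<close>). The letter \<open>c\<close> is consumed exactly when the unread input changes from \<open>c # v\<close> to \<open>v\<close>.
\<close>

definition two_tape_step ::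
  "('s, 'a option + 'a option, 'b) dpda \<Rightarrow> 's set \<Rightarrow> 's set \<Rightarrow>
     ('s, 'a option + 'a option, 'b) inst_desc \<Rightarrow> ('s, 'a option + 'a option, 'b) inst_desc \<Rightarrow> bool"
  where
  "two_tape_step T S\<^sub>1 S\<^sub>2 = (\<lambda>(w, y, s) (v, z, t). dpda_step T (w, y, s) (v, z, t) \<and>
     (\<forall>x. w = Inl x # v \<longrightarrow> s \<in> S\<^sub>1) \<and> (\<forall>x. w = Inr x # v \<longrightarrow> s \<in> S\<^sub>2))"

definition two_tape_lang ::
  "'a set \<Rightarrow> ('s, 'a option + 'a option, 'b) dpda \<Rightarrow> 's set \<Rightarrow> 's set \<Rightarrow> acc_mode \<Rightarrow>
     ('a list \<times> 'a list) set" where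
  "two_tape_lang A T S\<^sub>1 S\<^sub>2 m = {(u, v). u \<in> lists A \<and> v \<in> lists A \<and>
     (\<exists>w d. is_shuffle (end_marked u) (end_marked v) w \<and>
        (two_tape_step T S\<^sub>1 S\<^sub>2)\<^sup>*\<^sup>* (w, [start_symbol T], start_state T) d \<and> accepting T m d)}"

definition is_two_tape_language :: "'a set \<Rightarrow> ('a list \<times> 'a list) set \<Rightarrow> bool" where
  "is_two_tape_language A R \<longleftrightarrow>
     (\<exists>(T :: (nat, 'a option + 'a option, nat) dpda) S\<^sub>1 S\<^sub>2 m.
        is_two_tape_pda A T S\<^sub>1 S\<^sub>2 \<and> R = two_tape_lang A T S\<^sub>1 S\<^sub>2 m)"

definition async_two_tape_ppp :: "'a set \<Rightarrow> ('a list \<times> 'a list) set \<Rightarrow> bool" where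
  "async_two_tape_ppp A R \<longleftrightarrow>
     (\<exists>F. finite F \<and> F \<noteq> {} \<and> (\<forall>K \<in> F. is_two_tape_language A K) \<and> R = \<Inter>F)"


section \<open>Parallel poly-pushdown groups\<close>

definition word_value :: "('g, 'm) monoid_scheme \<Rightarrow> ('a \<Rightarrow> 'g) \<Rightarrow> 'a list \<Rightarrow> 'g" where
  "word_value G \<phi> w = foldr (\<lambda>a g. \<phi> a \<otimes>\<^bsub>G\<^esub> g) w \<one>\<^bsub>G\<^esub>"

definition ppp_structure ::
  "('g, 'm) monoid_scheme \<Rightarrow> 'a set \<Rightarrow> ('a \<Rightarrow> 'g) \<Rightarrow> 'a list set \<Rightarrow> bool" where
  "ppp_structure G A \<phi> L \<longleftrightarrow>
     bij_betw (word_value G \<phi>) L (carrier G) \<and>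
     parallel_poly_pushdown_language A L \<and>
     (\<forall>a \<in> A. async_two_tape_ppp A
        {(w, w'). w \<in> L \<and> w' \<in> L \<and> word_value G \<phi> w' = word_value G \<phi> (w @ [a])})"

text \<open>As for automata, taking the finite set \<open>A\<close> of letters inside \<^typ>\<open>nat\<close> only fixes names.\<close>

definition parallel_poly_pushdown_group :: "('g, 'm) monoid_scheme \<Rightarrow> bool" where
  "parallel_poly_pushdown_group G \<longleftrightarrow> group G \<and>
     (\<exists>(A :: nat set) \<phi> L. finite A \<and> \<phi> \<in> A \<rightarrow> carrier G \<and>
        word_value G \<phi> ` lists A = carrier G \<and> ppp_structure G A \<phi> L)"


section \<open>Finitely presented groups\<close>

text \<open>
  Words in the generators \<open>X\<close> and their formal inverses: \<open>(x, True)\<close> stands for \<open>x\<close> and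
  \<open>(x, False)\<close> for its inverse. The group with generators \<open>X\<close> and relators \<open>R\<close> is the quotient of
  the monoid of these words by the least congruence that makes \<open>(x, b)\<close> and \<open>(x, \<not> b)\<close> mutually
  inverse and every relator trivial.
\<close>

definition group_words :: "'x set \<Rightarrow> ('x \<times> bool) list set" where
  "group_words X = lists (X \<times> UNIV)"

inductive_set presentation_cong ::
  "'x set \<Rightarrow> ('x \<times> bool) list set \<Rightarrow> (('x \<times> bool) list \<times> ('x \<times> bool) list) set"
  for X R where
  cancel: "x \<in> X \<Longrightarrow> ([(x, b), (x, \<not> b)], []) \<in> presentation_cong X R"
| relator: "r \<in> R \<Longrightarrow> r \<in> group_words X \<Longrightarrow> (r, []) \<in> presentation_cong X R"
| refl: "u \<in> group_words X \<Longrightarrow> (u, u) \<in> presentation_cong X R"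
| sym: "(u, v) \<in> presentation_cong X R \<Longrightarrow> (v, u) \<in> presentation_cong X R"
| trans: "(u, v) \<in> presentation_cong X R \<Longrightarrow> (v, w) \<in> presentation_cong X R \<Longrightarrow>
    (u, w) \<in> presentation_cong X R"
| append: "(u, v) \<in> presentation_cong X R \<Longrightarrow> (u', v') \<in> presentation_cong X R \<Longrightarrow>
    (u @ u', v @ v') \<in> presentation_cong X R"

definition presented_group ::
  "'x set \<Rightarrow> ('x \<times> bool) list set \<Rightarrow> ('x \<times> bool) list set monoid" where
  "presented_group X R =
     \<lparr>carrier = group_words X // presentation_cong X R,
      mult = (\<lambda>P Q. \<Union>u \<in> P. \<Union>v \<in> Q. presentation_cong X R `` {u @ v}),
      one = presentation_cong X R `` {[]}\<rparr>"

definition finitely_presented :: "('g, 'm) monoid_scheme \<Rightarrow> bool" where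
  "finitely_presented G \<longleftrightarrow>
     (\<exists>(X :: nat set) R. finite X \<and> finite R \<and> R \<subseteq> group_words X \<and> G \<cong> presented_group X R)"

lemma presentation_cong_subset: "presentation_cong X R \<subseteq> group_words X \<times> group_words X"
proof -
  have "u \<in> group_words X \<and> v \<in> group_words X" if "(u, v) \<in> presentation_cong X R" for u v
    using that by induction (auto simp: group_words_def)
  then show ?thesis by auto
qed

lemma equiv_presentation_cong: "equiv (group_words X) (presentation_cong X R)"
proof (rule equivI)
  show "presentation_cong X R \<subseteq> group_words X \<times> group_words X"
    by (rule presentation_cong_subset)
  show "refl_on (group_words X) (presentation_cong X R)"
    by (rule refl_onI) (rule presentation_cong.refl)
  show "Relation.sym (presentation_cong X R)"
    by (rule symI) (rule presentation_cong.sym)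
  show "Relation.trans (presentation_cong X R)"
    by (rule transI) (rule presentation_cong.trans)
qed

lemma presentation_cong_inverse:
  "u \<in> group_words X \<Longrightarrow>
     (rev (map (\<lambda>(x, b). (x, \<not> b)) u) @ u, []) \<in> presentation_cong X R"
proof (induction u)
  case Nil
  then show ?case by (auto intro: presentation_cong.refl)
next
  case (Cons c u)
  obtain x b where c: "c = (x, b)" by force
  let ?u = "rev (map (\<lambda>(x, b). (x, \<not> b)) u)"
  have x: "x \<in> X" and u: "u \<in> group_words X" and u': "?u \<in> group_words X"
    using Cons.prems c by (auto simp: group_words_def)
  have "([(x, \<not> b), (x, b)], []) \<in> presentation_cong X R"
    using presentation_cong.cancel[OF x, of "\<not> b"] by simp
  then have "(?u @ [(x, \<not> b), (x, b)] @ u, ?u @ [] @ u) \<in> presentation_cong X R"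
    by (intro presentation_cong.append presentation_cong.refl u u')
  then have "(rev (map (\<lambda>(x, b). (x, \<not> b)) (c # u)) @ c # u, ?u @ u) \<in> presentation_cong X R"
    using c by simp
  then show ?case using Cons.IH[OF u] by (rule presentation_cong.trans)
qed

lemma presented_group_mult:
  assumes "u \<in> group_words X" "v \<in> group_words X"
  shows "presentation_cong X R `` {u} \<otimes>\<^bsub>presented_group X R\<^esub> presentation_cong X R `` {v} =
    presentation_cong X R `` {u @ v}"
proof -
  have "(\<lambda>u v. presentation_cong X R `` {u @ v}) respects2 presentation_cong X R"
    by (intro congruent2I' equiv_class_eq[OF equiv_presentation_cong] presentation_cong.append)
  then show ?thesis
    using UN_equiv_class2[OF equiv_presentation_cong equiv_presentation_cong _ assms]
    by (simp add: presented_group_def)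
qed

lemma group_presented_group: "group (presented_group X R)"
proof (rule groupI)
  let ?E = "presentation_cong X R" and ?G = "presented_group X R"
  have carrier: "P \<in> carrier ?G \<longleftrightarrow> (\<exists>u \<in> group_words X. P = ?E `` {u})" for P
    by (auto simp: presented_group_def quotient_def)
  have append: "u @ v \<in> group_words X" if "u \<in> group_words X" "v \<in> group_words X" for u v
    using that by (simp add: group_words_def)
  have nil: "[] \<in> group_words X" by (simp add: group_words_def)
  have one: "\<one>\<^bsub>?G\<^esub> = ?E `` {[]}" by (simp add: presented_group_def)
  show "P \<otimes>\<^bsub>?G\<^esub> Q \<in> carrier ?G" if "P \<in> carrier ?G" "Q \<in> carrier ?G" for P Q
    using that unfolding carrier by (auto simp: presented_group_mult intro: append)
  show "\<one>\<^bsub>?G\<^esub> \<in> carrier ?G"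
    unfolding carrier one using nil by blast
  show "P \<otimes>\<^bsub>?G\<^esub> Q \<otimes>\<^bsub>?G\<^esub> K = P \<otimes>\<^bsub>?G\<^esub> (Q \<otimes>\<^bsub>?G\<^esub> K)"
    if "P \<in> carrier ?G" "Q \<in> carrier ?G" "K \<in> carrier ?G" for P Q K
    using that unfolding carrier by (auto simp: presented_group_mult append)
  show "\<one>\<^bsub>?G\<^esub> \<otimes>\<^bsub>?G\<^esub> P = P" if "P \<in> carrier ?G" for P
    using that unfolding carrier one by (auto simp: presented_group_mult nil)
  show "\<exists>Q \<in> carrier ?G. Q \<otimes>\<^bsub>?G\<^esub> P = \<one>\<^bsub>?G\<^esub>" if P: "P \<in> carrier ?G" for P
  proof -
    obtain u where u: "u \<in> group_words X" "P = ?E `` {u}"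
      using P unfolding carrier by blast
    let ?u = "rev (map (\<lambda>(x, b). (x, \<not> b)) u)"
    have u': "?u \<in> group_words X" using u(1) by (auto simp: group_words_def)
    have "?E `` {?u} \<otimes>\<^bsub>?G\<^esub> P = ?E `` {?u @ u}"
      unfolding u(2) by (rule presented_group_mult[OF u' u(1)])
    also have "\<dots> = \<one>\<^bsub>?G\<^esub>" unfolding one
      by (rule equiv_class_eq[OF equiv_presentation_cong presentation_cong_inverse[OF u(1)]])
    finally have "?E `` {?u} \<otimes>\<^bsub>?G\<^esub> P = \<one>\<^bsub>?G\<^esub>" .
    moreover have "?E `` {?u} \<in> carrier ?G" unfolding carrier using u' by blast
    ultimately show ?thesis by (rule bexI)
  qed
qed

end

theory Submission
  imports Defs "HOL-Algebra.Weak_Morphisms" "HOL-Library.Countable_Set" "HOL-Library.More_List"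
begin

text \<open>
  The witness is the lamplighter group, the wreath product of the group of order two with the
  integers. An element is a pair \<open>(n, T)\<close> of the position \<open>n\<close> of the lamplighter and the finite set
  \<open>T\<close> of lit lamps, where lamps are addressed relative to the lamplighter. It is generated by the
  step \<open>t\<close> to the right and the switch \<open>a\<close> of the lamp at the current position.

  It is not finitely presented because it is a limit of marked groups in which a relation of it
  fails. Let \<open>t\<close> act on the integers by \<open>x \<mapsto> x + 1\<close> and \<open>a\<close> by the transposition of \<open>0\<close> and \<open>k\<close>.
  The conjugates of \<open>a\<close> by powers of \<open>t\<close> are the transpositions of \<open>i\<close> and \<open>i + k\<close>; those with
  \<open>\<bar>i\<bar> < k / 2\<close> commute, so every single relation of the lamplighter group holds once \<open>k\<close> is large
  (\<open>approx_mult\<close>). A finite presentation would turn this into an honest homomorphism for some large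
  \<open>k\<close> (\<open>presented_group_local_hom_lift\<close>), but the transpositions for \<open>i = 0\<close> and \<open>i = k\<close> share the
  point \<open>k\<close> and do not commute.

  It is a parallel poly-pushdown group for the following normal form of \<open>(n, T)\<close>: first \<open>t ^ n\<close>, then
  a sweep to the right that sets the lamps at and after the position \<open>n\<close>, the way back, a sweep to
  the left for the remaining lamps, and the way back again. Separate letters are used for the
  initial power, for the cells visited in a sweep (one letter for each content) and for the ways
  back. Checking that each way back has the right length takes a single counter, so the normal forms
  are a deterministic pushdown language (\<open>nf_accepts_iff\<close>). Since lamps are addressed relative to
  the final position, right multiplication by \<open>a ^ c * t\<close> has a purely local effect: the exponent
  grows by one, the first cell of the right sweep is removed, switched if \<open>c\<close> holds, and becomes the
  first cell of the left sweep (\<open>nf_value_shift\<close>). Each of these three effects says that two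
  letter-by-letter transducers produce the same output on the two words, which an asynchronous
  two-tape automaton without a stack can compare (\<open>two_tape_accepts_compare\<close>); together with
  membership in the language on either tape this gives the multiplier relation as an intersection of
  five two-tape languages. The inverse letters need the converse relations, for which the two
  transducers change places.
\<close>

section \<open>The lamplighter group\<close>

text \<open>
  The set of lit lamps is a predicate with finite support. As \<open>T\<close> is taken relative to the position,
  moving on by \<open>m\<close> turns it into \<open>\<lambda>i. T (i + m)\<close>, and \<open>(n, T)\<close> is \<open>t ^ n\<close> followed by the switches at the
  offsets in \<open>T\<close>.
\<close>

definition lamplighter :: "(int \<times> (int \<Rightarrow> bool)) monoid" where
  "lamplighter =
     \<lparr>carrier = UNIV \<times> {T. finite {i. T i}},
      mult = (\<lambda>(n, T) (m, U). (n + m, \<lambda>i. T (i + m) \<noteq> U i)),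
      one = (0, \<lambda>_. False)\<rparr>"

lemma lamplighter_simps [simp]:
  "(n, T) \<in> carrier lamplighter \<longleftrightarrow> finite {i. T i}"
  "(n, T) \<otimes>\<^bsub>lamplighter\<^esub> (m, U) = (n + m, \<lambda>i. T (i + m) \<noteq> U i)"
  "\<one>\<^bsub>lamplighter\<^esub> = (0, \<lambda>_. False)"
  by (auto simp: lamplighter_def)

lemma finite_shift: "finite {i :: int. T (i + m)} \<longleftrightarrow> finite {i. T i}"
proof -
  have "{i. T i} = (\<lambda>i. i + m) ` {i. T (i + m)}"
  proof
    show "{i. T i} \<subseteq> (\<lambda>i. i + m) ` {i. T (i + m)}"
    proof
      show "i \<in> (\<lambda>i. i + m) ` {i. T (i + m)}" if "i \<in> {i. T i}" for i
        using that by (intro image_eqI[of _ _ "i - m"]) auto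
    qed
  qed auto
  moreover have "inj_on (\<lambda>i. i + m) {i. T (i + m)}" by (simp add: inj_on_def)
  ultimately show ?thesis by (simp add: finite_image_iff)
qed

lemma finite_symm_diff:
  "finite {i. T i} \<Longrightarrow> finite {i. U i} \<Longrightarrow> finite {i :: int. T (i + m) \<noteq> U i}"
  by (rule finite_subset[of _ "{i. T (i + m)} \<union> {i. U i}"]) (auto simp: finite_shift)

lemma lamplighter_closed:
  "g \<in> carrier lamplighter \<Longrightarrow> h \<in> carrier lamplighter \<Longrightarrow>
     g \<otimes>\<^bsub>lamplighter\<^esub> h \<in> carrier lamplighter"
  by (cases g; cases h) (simp add: finite_symm_diff del: not_iff)

lemma group_lamplighter: "group lamplighter"
proof (rule groupI)
  fix g assume g: "g \<in> carrier lamplighter"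
  obtain n T where [simp]: "g = (n, T)" by force
  have "(- n, \<lambda>i. T (i + - n)) \<in> carrier lamplighter"
    using g by (simp only: lamplighter_simps finite_shift \<open>g = (n, T)\<close>)
  then show "\<exists>h \<in> carrier lamplighter. h \<otimes>\<^bsub>lamplighter\<^esub> g = \<one>\<^bsub>lamplighter\<^esub>"
    by (rule bexI[rotated]) simp
qed (auto simp: add.assoc add.commute add.left_commute intro: lamplighter_closed
       simp del: not_iff)

interpretation lamplighter: group lamplighter
  by (rule group_lamplighter)

lemma countable_lamplighter: "countable (carrier lamplighter)"
proof -
  have "{T :: int \<Rightarrow> bool. finite {i. T i}} = (\<lambda>S i. i \<in> S) ` {S. finite S}"
    by (auto simp: image_iff intro!: exI[of _ "{i. _ i}"])
  then have "countable {T :: int \<Rightarrow> bool. finite {i. T i}}"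
    using countable_Collect_finite[where ?'a = int] by (metis countable_image)
  then show ?thesis by (auto simp: lamplighter_def intro!: countable_SIGMA)
qed

section \<open>The lamplighter group is not finitely presented\<close>

text \<open>
  The product of the transpositions of \<open>i\<close> and \<open>i + k\<close>, over all \<open>i\<close> with \<open>T i\<close>, provided that these
  transpositions are disjoint.
\<close>

definition swap_by :: "int \<Rightarrow> (int \<Rightarrow> bool) \<Rightarrow> int \<Rightarrow> int" where
  "swap_by k T x = (if T x then x + k else if T (x - k) then x - k else x)"

text \<open>
  For \<open>k\<close> large in comparison with \<open>T\<close>, this is what \<open>t ^ n\<close> followed by the switches in \<open>T\<close> becomes
  when \<open>t\<close> acts as the shift and \<open>a\<close> as the transposition of \<open>0\<close> and \<open>k\<close>. It is not a homomorphism for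
  any \<open>k > 0\<close>.
\<close>

definition approx :: "nat \<Rightarrow> int \<times> (int \<Rightarrow> bool) \<Rightarrow> int \<Rightarrow> int" where
  "approx k = (\<lambda>(n, T) x. n + swap_by (int k) T x)"

lemma approx_one: "approx k \<one>\<^bsub>lamplighter\<^esub> = id"
  by (auto simp: approx_def swap_by_def)

text \<open>
  The transpositions involved are pairwise disjoint because their first points lie in an interval
  shorter than \<open>k\<close>; so they commute, and those occurring twice cancel.
\<close>

lemma swap_by_symm_diff:
  assumes "\<And>i. T i \<Longrightarrow> \<bar>i\<bar> < N" "\<And>i. U i \<Longrightarrow> \<bar>i\<bar> < N" "2 * N \<le> k"
  shows "swap_by k T (swap_by k U x) = swap_by k (\<lambda>i. T i \<noteq> U i) x"
proof -
  have near: "\<bar>i\<bar> < N" if "T i \<or> U i" for i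
    using assms(1,2)[of i] that by blast
  have "\<not> (T (i + k) \<or> U (i + k)) \<and> \<not> (T (i - k) \<or> U (i - k))"
    if "T i \<or> U i" for i
    using near[OF that] near[of "i + k"] near[of "i - k"] assms(3) by linarith
  from this[of x] this[of "x - k"] show ?thesis
    by (cases "T x"; cases "U x"; cases "T (x - k)"; cases "U (x - k)") (simp_all add: swap_by_def)
qed

text \<open>
  Only finitely many lamps are involved in a single product, so all \<open>k\<close> above twice the largest
  offset will do.
\<close>

lemma approx_mult:
  assumes "g \<in> carrier lamplighter" "h \<in> carrier lamplighter"
  shows "\<forall>\<^sub>F k in sequentially.
           approx k (g \<otimes>\<^bsub>lamplighter\<^esub> h) = approx k g \<circ> approx k h"
proof -
  obtain n T m U where gh: "g = (n, T)" "h = (m, U)" by force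
  let ?T = "\<lambda>i. T (i + m)"
  have "finite ({i. ?T i} \<union> {i. U i})"
    using assms by (simp add: gh finite_shift)
  then obtain N where "abs ` ({i. ?T i} \<union> {i. U i}) \<subseteq> {..<N}"
    using finite_int_iff_bounded by blast
  then have N: "\<bar>i\<bar> < N" if "?T i \<or> U i" for i
    using that by blast
  have "approx k (g \<otimes>\<^bsub>lamplighter\<^esub> h) = approx k g \<circ> approx k h" if k: "k \<ge> nat (2 * N)" for k
  proof
    fix x
    have "swap_by (int k) T (m + y) = m + swap_by (int k) ?T y" for y
      by (simp add: swap_by_def add.commute add_diff_eq)
    moreover have "swap_by (int k) ?T (swap_by (int k) U x) = swap_by (int k) (\<lambda>i. ?T i \<noteq> U i) x"
      by (rule swap_by_symm_diff[of _ N]) (use N k in auto)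
    ultimately show "approx k (g \<otimes>\<^bsub>lamplighter\<^esub> h) x = (approx k g \<circ> approx k h) x"
      by (simp add: gh approx_def)
  qed
  then show ?thesis by (auto simp: eventually_sequentially)
qed

text \<open>
  A finite presentation involves finitely many relators, and each of them is a finite product.
  Maps \<open>\<theta> k\<close> into functions under composition that respect every single product for large \<open>k\<close> therefore
  respect all relators at once for large \<open>k\<close>. Evaluating words through the images of the generators
  under \<open>\<theta> k\<close> is then compatible with the congruence of the presentation, so it defines a
  homomorphism, and it still agrees with \<open>\<theta> k\<close> on any prescribed finite set.
\<close>

lemma presented_group_local_hom_lift:
  fixes \<theta> :: "nat \<Rightarrow> 'g \<Rightarrow> 'p \<Rightarrow> 'p" and G (structure)
  assumes X: "finite X" and R: "finite R" "R \<subseteq> group_words X"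
    and iso: "presented_group X R \<cong> G" and G: "group G"
    and one: "\<And>k. \<theta> k \<one> = id"
    and mult: "\<And>g h. g \<in> carrier G \<Longrightarrow> h \<in> carrier G \<Longrightarrow>
          \<forall>\<^sub>F k in sequentially. \<theta> k (g \<otimes> h) = \<theta> k g \<circ> \<theta> k h"
    and E: "finite E" "E \<subseteq> carrier G"
  shows "\<forall>\<^sub>F k in sequentially. \<exists>F.
           (\<forall>g \<in> carrier G. \<forall>h \<in> carrier G. F (g \<otimes> h) = F g \<circ> F h) \<and> (\<forall>g \<in> E. F g = \<theta> k g)"
proof -
  let ?C = "presentation_cong X R" and ?P = "presented_group X R"
  obtain \<psi> where \<psi>: "\<psi> \<in> hom ?P G" "bij_betw \<psi> (carrier ?P) (carrier G)"
    using iso by (auto simp: is_iso_def iso_def)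
  define val where "val u = \<psi> (?C `` {u})" for u
  have cls: "?C `` {u} \<in> carrier ?P" if "u \<in> group_words X" for u
    using that by (simp add: presented_group_def quotientI)
  have val_closed: "val u \<in> carrier G" if "u \<in> group_words X" for u
    unfolding val_def using \<psi>(1) cls[OF that] by (auto simp: hom_def)
  have val_append: "val (u @ v) = val u \<otimes> val v"
    if "u \<in> group_words X" "v \<in> group_words X" for u v
    unfolding val_def using hom_mult[OF \<psi>(1) cls[OF that(1)] cls[OF that(2)]] that
    by (simp add: presented_group_mult)
  have val_nil: "val [] = \<one>"
    unfolding val_def using hom_one[OF \<psi>(1) group_presented_group G]
    by (simp add: presented_group_def)
  have val_cong: "val u = val v" if "(u, v) \<in> ?C" for u v
    unfolding val_def using that equiv_class_eq[OF equiv_presentation_cong] by metis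
  have cong_if_val: "(u, v) \<in> ?C"
    if "u \<in> group_words X" "v \<in> group_words X" "val u = val v" for u v
    using that cls \<psi>(2) unfolding val_def
    by (meson bij_betw_imp_inj_on eq_equiv_class equiv_presentation_cong inj_onD)
  have val_surj: "\<exists>u \<in> group_words X. val u = g" if g: "g \<in> carrier G" for g
  proof -
    obtain P where "P \<in> carrier ?P" "\<psi> P = g"
      using \<psi>(2) g by (metis bij_betw_imp_surj_on imageE)
    then show ?thesis
      unfolding val_def by (auto simp: presented_group_def elim: quotientE)
  qed

  \<comment> \<open>An inverse letter is sent to the image of the inverse, not to the inverse of the image; this
    makes sense without knowing that \<theta> k has values in permutations. The cancellation rules of the
    presentation then count as finitely many further relations to be respected.\<close>
  define eva where "eva k w = foldr (\<lambda>c. (\<circ>) (\<theta> k (val [c]))) w id" for k w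
  have eva_append: "eva k (u @ v) = eva k u \<circ> eva k v" for k u v
    by (induction u) (simp_all add: eva_def o_assoc)
  have eva_val: "\<forall>\<^sub>F k in sequentially. eva k w = \<theta> k (val w)" if "w \<in> group_words X" for w
    using that
  proof (induction w)
    case Nil
    show ?case by (simp add: eva_def val_nil one)
  next
    case (Cons c w)
    then have c: "[c] \<in> group_words X" and w: "w \<in> group_words X" by (auto simp: group_words_def)
    from Cons.IH[OF w] mult[OF val_closed[OF c] val_closed[OF w]] show ?case
    proof eventually_elim
      case (elim k)
      then show ?case using val_append[OF c w] by (simp add: eva_def)
    qed
  qed
  have triv: "\<forall>\<^sub>F k in sequentially. eva k w = id" if w: "(w, []) \<in> ?C" for w
  proof -
    have "w \<in> group_words X" using w presentation_cong_subset by blast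
    moreover have "val w = \<one>" using val_cong[OF w] val_nil by simp
    ultimately show ?thesis using eva_val[of w] by (simp add: one)
  qed
  have "\<forall>\<^sub>F k in sequentially. \<forall>r \<in> R. eva k r = id"
    using R by (intro eventually_ball_finite ballI triv presentation_cong.relator) auto
  moreover have "\<forall>\<^sub>F k in sequentially. \<forall>(x, b) \<in> X \<times> UNIV. eva k [(x, b), (x, \<not> b)] = id"
    using X by (intro eventually_ball_finite) (auto intro!: triv presentation_cong.cancel)
  moreover define word where "word g = (SOME u. u \<in> group_words X \<and> val u = g)" for g
  have word: "word g \<in> group_words X" "val (word g) = g" if "g \<in> carrier G" for g
    using someI_ex[of "\<lambda>u. u \<in> group_words X \<and> val u = g"] val_surj[OF that]
    unfolding word_def by blast+
  have "\<forall>\<^sub>F k in sequentially. \<forall>g \<in> E. eva k (word g) = \<theta> k g"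
    using E by (intro eventually_ball_finite ballI) (use eva_val word in fastforce)+
  ultimately show ?thesis
  proof eventually_elim
    case (elim k)
    have eva_cong: "eva k u = eva k v" if "(u, v) \<in> ?C" for u v
      using that
    proof induction
      case (cancel x b)
      then show ?case using elim(2) by (auto simp: eva_def)
    next
      case (relator r)
      then show ?case using elim(1) by (simp add: eva_def)
    qed (simp_all add: eva_append)
    have "eva k (word (g \<otimes> h)) = eva k (word g) \<circ> eva k (word h)"
      if g: "g \<in> carrier G" and h: "h \<in> carrier G" for g h
    proof -
      have gh: "g \<otimes> h \<in> carrier G" using G g h by (simp add: group.is_monoid monoid.m_closed)
      have "word g @ word h \<in> group_words X"
        using word(1)[OF g] word(1)[OF h] by (simp add: group_words_def)
      moreover have "val (word g @ word h) = g \<otimes> h"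
        using val_append word g h by simp
      ultimately have "(word (g \<otimes> h), word g @ word h) \<in> ?C"
        using word[OF gh] by (intro cong_if_val) auto
      then show ?thesis using eva_cong eva_append by metis
    qed
    with elim(3) show ?case by (intro exI[of _ "\<lambda>g. eva k (word g)"]) blast
  qed
qed

text \<open>
  The homomorphism obtained for a large \<open>k\<close> is forced on all powers of \<open>t\<close> by its values on \<open>t\<close> and its
  inverse, so it has to preserve the relation between \<open>a\<close> and its conjugate by \<open>t ^ k\<close>, although \<open>k\<close>
  was not known when the finite set of prescribed values was chosen.
\<close>

theorem lamplighter_not_finitely_presented: "\<not> finitely_presented lamplighter"
proof
  assume "finitely_presented lamplighter"
  then obtain X :: "nat set" and R where fp: "finite X" "finite R" "R \<subseteq> group_words X"
    and iso: "lamplighter \<cong> presented_group X R"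
    unfolding finitely_presented_def by blast
  let ?G = lamplighter
  define a where "a = (0 :: int, \<lambda>i :: int. i = 0)"
  define t where "t n = (n, \<lambda>i :: int. False)" for n :: int
  have [simp]: "a \<in> carrier ?G" "t n \<in> carrier ?G" for n by (simp_all add: a_def t_def)
  define lifts where "lifts k F \<longleftrightarrow>
      (\<forall>g \<in> carrier ?G. \<forall>h \<in> carrier ?G. F (g \<otimes>\<^bsub>?G\<^esub> h) = F g \<circ> F h) \<and>
      (\<forall>g \<in> {a, t 1, t (- 1), t 0}. F g = approx k g)" for k F
  have "\<forall>\<^sub>F k in sequentially. \<exists>F. lifts k F"
    unfolding lifts_def using lamplighter.iso_sym[OF iso] fp
    by (intro presented_group_local_hom_lift[of X R] approx_mult approx_one group_lamplighter) auto
  then have "\<forall>\<^sub>F k in sequentially. k > 0 \<and> (\<exists>F. lifts k F)"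
    by (intro eventually_conj eventually_gt_at_top)
  then obtain k F where k: "k > 0" and "lifts k F"
    using eventually_happens'[OF sequentially_bot] by blast
  then have hom: "\<And>g h. g \<in> carrier ?G \<Longrightarrow> h \<in> carrier ?G \<Longrightarrow> F (g \<otimes>\<^bsub>?G\<^esub> h) = F g \<circ> F h"
    and F: "F a = approx k a" "F (t 1) = approx k (t 1)" "F (t (- 1)) = approx k (t (- 1))"
      "F (t 0) = approx k (t 0)"
    by (simp_all add: lifts_def)
  have shift: "F (t (int n)) = (+) (int n) \<and> F (t (- int n)) = (+) (- int n)" for n
  proof (induction n)
    case 0
    show ?case using F(4) by (auto simp: approx_def t_def swap_by_def)
  next
    case (Suc n)
    have "t (int (Suc n)) = t 1 \<otimes>\<^bsub>?G\<^esub> t (int n)" "t (- int (Suc n)) = t (- 1) \<otimes>\<^bsub>?G\<^esub> t (- int n)"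
      by (simp_all add: t_def)
    then have "F (t (int (Suc n))) = F (t 1) \<circ> F (t (int n))"
      "F (t (- int (Suc n))) = F (t (- 1)) \<circ> F (t (- int n))"
      using hom by simp_all
    with Suc F show ?case by (auto simp: fun_eq_iff approx_def t_def swap_by_def)
  qed
  \<comment> \<open>The conjugate of a by t ^ k is sent to the transposition of k and 2 k, which does not commute
    with that of 0 and k; the two products already differ at the point 0.\<close>
  let ?b = "t (int k) \<otimes>\<^bsub>?G\<^esub> (a \<otimes>\<^bsub>?G\<^esub> t (- int k))"
  have b: "?b \<in> carrier ?G" by (intro lamplighter_closed) simp_all
  have "a \<otimes>\<^bsub>?G\<^esub> ?b = ?b \<otimes>\<^bsub>?G\<^esub> a"
    by (auto simp: a_def t_def)
  then have "F a \<circ> F ?b = F ?b \<circ> F a"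
    using hom b by (metis \<open>a \<in> carrier ?G\<close>)
  moreover have "F ?b = F (t (int k)) \<circ> (F a \<circ> F (t (- int k)))"
    using hom lamplighter_closed by simp
  ultimately have "F a (F (t (int k)) (F a (F (t (- int k)) 0))) =
      F (t (int k)) (F a (F (t (- int k)) (F a 0)))"
    by (metis comp_apply)
  then show False
    using k by (simp add: shift F(1)) (simp add: approx_def a_def swap_by_def)
qed

section \<open>Real-time one-counter automata\<close>

text \<open>
  All pushdown automata below use the stack as a counter and read a letter in every step. The
  argument of type \<^typ>\<open>bool\<close> tells whether the counter is zero. A step first decreases a positive
  counter by one, since a pushdown automaton removes the top of the stack, and then adds the given
  number.
\<close>

type_synonym ('s, 'c) counter_delta = "'s \<Rightarrow> bool \<Rightarrow> 'c \<Rightarrow> 's \<times> nat"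

text \<open>
  The symbol 0 marks the bottom. As it is never removed, the automaton cannot run into an empty
  stack.
\<close>

definition counter_stack :: "nat \<Rightarrow> nat list" where
  "counter_stack n = 0 # replicate n 1"

lemma counter_stack_eq_snoc:
  "counter_stack n = y @ [b] \<longleftrightarrow> (if n = 0 then y = [] \<and> b = 0 else y = counter_stack (n - 1) \<and> b = 1)"
proof (cases n)
  case (Suc m)
  then have "counter_stack n = counter_stack m @ [1]"
    by (simp add: counter_stack_def flip: replicate_append_same)
  with Suc show ?thesis by auto
qed (auto simp: counter_stack_def)

text \<open>
  States are named by numbers, and the letters of an abstract finite type \<^typ>\<open>'c\<close> are represented
  by \<open>e\<close> in the input alphabet.
\<close>

definition counter_dpda ::
  "('c \<Rightarrow> 'a) \<Rightarrow> ('s :: finite, 'c :: finite) counter_delta \<Rightarrow> ('s \<Rightarrow> bool) \<Rightarrow> 's \<Rightarrow> (nat, 'a, nat) dpda" where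
  "counter_dpda e \<delta> F s\<^sub>0 =
     \<lparr>states = range (to_nat :: 's \<Rightarrow> nat), input_alph = range e, stack_alph = {0, 1},
      delta = (\<lambda>(x, b, s). case x of None \<Rightarrow> None
        | Some c \<Rightarrow> if c \<in> range e \<and> b \<in> {0, 1} \<and> s \<in> range (to_nat :: 's \<Rightarrow> nat)
            then (case \<delta> (from_nat s) (b = 0) (inv_into UNIV e c) of (t, k) \<Rightarrow>
              Some (to_nat t, (if b = 0 then [0] else []) @ replicate k 1))
            else None),
      start_state = to_nat s\<^sub>0, start_symbol = 0, final_states = to_nat ` {s. F s}\<rparr>"

lemma counter_dpda_simps [simp]:
  "states (counter_dpda e \<delta> F s\<^sub>0) = range (to_nat :: 's \<Rightarrow> nat)"
  "input_alph (counter_dpda e \<delta> F s\<^sub>0) = range e"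
  "stack_alph (counter_dpda e \<delta> F s\<^sub>0) = {0, 1}"
  "start_state (counter_dpda e \<delta> F s\<^sub>0) = to_nat s\<^sub>0"
  "start_symbol (counter_dpda e \<delta> F s\<^sub>0) = 0"
  "final_states (counter_dpda e \<delta> F s\<^sub>0) = to_nat ` {s. F s}"
  for \<delta> :: "('s :: finite, 'c :: finite) counter_delta"
  by (simp_all add: counter_dpda_def)

lemma counter_dpda_delta_None: "delta (counter_dpda e \<delta> F s\<^sub>0) (None, b, s) = None"
  by (simp add: counter_dpda_def)

lemma counter_dpda_delta_Some:
  "inj e \<Longrightarrow> b \<in> {0, 1} \<Longrightarrow> delta (counter_dpda e \<delta> F s\<^sub>0) (Some (e c), b, to_nat s) =
     Some (to_nat (fst (\<delta> s (b = 0) c)), (if b = 0 then [0] else []) @ replicate (snd (\<delta> s (b = 0) c)) 1)"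
  by (auto simp: counter_dpda_def split: prod.splits)

lemma is_dpda_counter_dpda: "is_dpda (counter_dpda e \<delta> F s\<^sub>0)"
proof -
  let ?M = "counter_dpda e \<delta> F s\<^sub>0"
  have "(t, \<alpha>) \<in> states ?M \<times> lists (stack_alph ?M)"
    if "delta ?M (x, b, s) = Some (t, \<alpha>)" for x b s t \<alpha>
    using that by (cases x) (auto simp: counter_dpda_def split: if_splits prod.splits)
  then have "ran (delta ?M) \<subseteq> states ?M \<times> lists (stack_alph ?M)"
    unfolding ran_def by fast
  then show ?thesis
    unfolding is_dpda_def
    by (intro conjI) (auto simp: counter_dpda_def split: option.splits if_splits prod.splits)
qed

lemma counter_dpda_step:
  assumes e: "inj e"
  shows "dpda_step (counter_dpda e \<delta> F s\<^sub>0) (map e w, counter_stack n, to_nat s) d \<longleftrightarrow>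
     (\<exists>x w' t k. w = x # w' \<and> \<delta> s (n = 0) x = (t, k) \<and>
        d = (map e w', counter_stack (n - 1 + k), to_nat t))" (is "?l \<longleftrightarrow> ?r")
proof
  assume ?l
  then obtain b t \<alpha> a v y where read: "map e w = a # v" "counter_stack n = y @ [b]"
      "d = (v, y @ \<alpha>, t)" "delta (counter_dpda e \<delta> F s\<^sub>0) (Some a, b, to_nat s) = Some (t, \<alpha>)"
    by (auto elim!: dpda_step.cases simp: counter_dpda_delta_None)
  then obtain x w' where w: "w = x # w'" "a = e x" "v = map e w'" by auto
  have b: "b \<in> {0, 1}" "(b = 0) = (n = 0)" and y: "y = (if n = 0 then [] else counter_stack (n - 1))"
    using read(2) by (auto simp: counter_stack_eq_snoc split: if_splits)
  obtain t' k where \<delta>: "\<delta> s (n = 0) x = (t', k)" by force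
  have "y @ \<alpha> = counter_stack (n - 1 + k)" "t = to_nat t'"
    using read b y w counter_dpda_delta_Some[OF e b(1), of \<delta> F s\<^sub>0 x s] \<delta>
    by (auto simp: counter_stack_def replicate_add split: if_splits)
  with w \<delta> read show ?r by auto
next
  assume ?r
  then obtain x w' t k where *: "w = x # w'" "\<delta> s (n = 0) x = (t, k)"
      "d = (map e w', counter_stack (n - 1 + k), to_nat t)" by blast
  define b y where "b = (if n = 0 then 0 else 1 :: nat)"
    and "y = (if n = 0 then [] else counter_stack (n - 1))"
  have "counter_stack n = y @ [b]" by (simp add: counter_stack_eq_snoc b_def y_def)
  moreover have "counter_stack (n - 1 + k) = y @ (if b = 0 then [0] else []) @ replicate k 1"
    by (auto simp: counter_stack_def replicate_add b_def y_def)
  moreover have "delta (counter_dpda e \<delta> F s\<^sub>0) (Some (e x), b, to_nat s) =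
      Some (to_nat t, (if b = 0 then [0] else []) @ replicate k 1)"
    using counter_dpda_delta_Some[OF e, of b \<delta> F s\<^sub>0 x s] * by (auto simp: b_def split: if_splits)
  ultimately show ?l
    using * dpda_step.read[of "counter_dpda e \<delta> F s\<^sub>0"] by simp
qed

fun counter_accepts :: "('s, 'c) counter_delta \<Rightarrow> ('s \<Rightarrow> bool) \<Rightarrow> 's \<Rightarrow> nat \<Rightarrow> 'c list \<Rightarrow> bool" where
  "counter_accepts \<delta> F s n [] \<longleftrightarrow> F s"
| "counter_accepts \<delta> F s n (x # w) \<longleftrightarrow>
     (case \<delta> s (n = 0) x of (t, k) \<Rightarrow> counter_accepts \<delta> F t (n - 1 + k) w)"

lemma rtranclp_accept_iff:
  "(\<exists>d. r\<^sup>*\<^sup>* c d \<and> P d) \<longleftrightarrow> P c \<or> (\<exists>c'. r c c' \<and> (\<exists>d. r\<^sup>*\<^sup>* c' d \<and> P d))"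
  by (metis converse_rtranclpE converse_rtranclp_into_rtranclp rtranclp.rtrancl_refl)

lemma counter_dpda_accepts_iff:
  assumes "inj e"
  shows "(\<exists>d. (dpda_step (counter_dpda e \<delta> F s\<^sub>0))\<^sup>*\<^sup>* (map e w, counter_stack n, to_nat s) d \<and>
       accepting (counter_dpda e \<delta> F s\<^sub>0) Final_State d) \<longleftrightarrow> counter_accepts \<delta> F s n w"
proof (induction w arbitrary: s n)
  case Nil
  then show ?case
    by (subst rtranclp_accept_iff) (auto simp: counter_dpda_step[OF assms, of _ _ _ "[]", simplified])
next
  case (Cons x w)
  obtain t k where \<delta>: "\<delta> s (n = 0) x = (t, k)" by force
  have step: "dpda_step (counter_dpda e \<delta> F s\<^sub>0) (map e (x # w), counter_stack n, to_nat s) d \<longleftrightarrow>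
      d = (map e w, counter_stack (n - 1 + k), to_nat t)" for d
    unfolding counter_dpda_step[OF assms] using \<delta> by auto
  show ?case
    by (subst rtranclp_accept_iff, subst step) (simp add: Cons.IH \<delta> del: split_paired_Ex)
qed

lemma is_dpda_language_counter:
  fixes e :: "'c :: finite \<Rightarrow> 'a" and \<delta> :: "('s :: finite, 'c) counter_delta"
  assumes "inj e"
  shows "is_dpda_language (range e) (map e ` {w. counter_accepts \<delta> F s 0 w})"
proof -
  have "dpda_lang (counter_dpda e \<delta> F s) Final_State = map e ` {w. counter_accepts \<delta> F s 0 w}"
    unfolding dpda_lang_def lists_image lists_UNIV counter_dpda_simps
    using counter_dpda_accepts_iff[OF assms, of \<delta> F s _ 0 s]
    by (auto simp: counter_stack_def simp del: split_paired_Ex)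
  then show ?thesis
    unfolding is_dpda_language_def using is_dpda_counter_dpda
    by (intro exI[of _ "counter_dpda e \<delta> F s"] exI[of _ Final_State]) auto
qed

section \<open>Two-tape counter automata\<close>

text \<open>
  As the state determines the tape that is read next, at most one shuffle of two words can be
  accepted. This function follows that shuffle without mentioning it.
\<close>

fun two_tape_accepts ::
  "('s, 'c) counter_delta \<Rightarrow> ('s \<Rightarrow> bool) \<Rightarrow> ('s \<Rightarrow> bool) \<Rightarrow> 's \<Rightarrow> nat \<Rightarrow> 'c list \<Rightarrow> 'c list \<Rightarrow> bool"
  where
  "two_tape_accepts \<delta> fst_tape F s n u v =
     (if fst_tape s then
        (case u of [] \<Rightarrow> v = [] \<and> F s
         | x # u' \<Rightarrow> (case \<delta> s (n = 0) x of (t, k) \<Rightarrow> two_tape_accepts \<delta> fst_tape F t (n - 1 + k) u' v))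
      else
        (case v of [] \<Rightarrow> u = [] \<and> F s
         | y # v' \<Rightarrow> (case \<delta> s (n = 0) y of (t, k) \<Rightarrow> two_tape_accepts \<delta> fst_tape F t (n - 1 + k) u v')))"

declare two_tape_accepts.simps [simp del]

fun untag :: "'c + 'c \<Rightarrow> 'c" where
  "untag (Inl x) = x"
| "untag (Inr x) = x"

text \<open>
  The same automaton on a word in which the letters are already shuffled: the step fails if the next
  letter belongs to the other tape.
\<close>

fun shuffle_accepts ::
  "('s, 'c) counter_delta \<Rightarrow> ('s \<Rightarrow> bool) \<Rightarrow> ('s \<Rightarrow> bool) \<Rightarrow> 's \<Rightarrow> nat \<Rightarrow> ('c + 'c) list \<Rightarrow> bool" where
  "shuffle_accepts \<delta> fst_tape F s n [] \<longleftrightarrow> F s"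
| "shuffle_accepts \<delta> fst_tape F s n (x # w) \<longleftrightarrow> isl x = fst_tape s \<and>
     (case \<delta> s (n = 0) (untag x) of (t, k) \<Rightarrow> shuffle_accepts \<delta> fst_tape F t (n - 1 + k) w)"

lemma two_tape_accepts_iff_shuffle:
  "two_tape_accepts \<delta> fst_tape F s n u v \<longleftrightarrow>
     (\<exists>w \<in> shuffles (map Inl u) (map Inr v). shuffle_accepts \<delta> fst_tape F s n w)"
proof (induction \<delta> fst_tape F s n u v rule: two_tape_accepts.induct)
  case (1 \<delta> fst_tape F s n u v)
  let ?S = "\<lambda>u v. shuffles (map Inl u) (map Inr v) :: ('b + 'b) list set"
  show ?case
  proof (cases "fst_tape s")
    case True
    show ?thesis
    proof (cases u)
      case Nil
      with True show ?thesis
        by (subst two_tape_accepts.simps) (cases v; auto)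
    next
      case (Cons x u')
      obtain t k where \<delta>: "\<delta> s (n = 0) x = (t, k)" by force
      have "(\<exists>w \<in> ?S u v. shuffle_accepts \<delta> fst_tape F s n w) \<longleftrightarrow>
          (\<exists>w \<in> ?S u' v. shuffle_accepts \<delta> fst_tape F t (n - 1 + k) w)"
      proof
        assume "\<exists>w \<in> ?S u v. shuffle_accepts \<delta> fst_tape F s n w"
        then obtain w where w: "w \<in> ?S u v" "shuffle_accepts \<delta> fst_tape F s n w" ..
        then obtain c w' where c: "w = c # w'" using Cons by (cases w) auto
        with w True Cons have "w' \<in> ?S u' v" "c = Inl x"
          by (cases v; auto simp: Cons_in_shuffles_iff)+
        with w c \<delta> show "\<exists>w \<in> ?S u' v. shuffle_accepts \<delta> fst_tape F t (n - 1 + k) w" by auto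
      next
        assume "\<exists>w \<in> ?S u' v. shuffle_accepts \<delta> fst_tape F t (n - 1 + k) w"
        then obtain w where "w \<in> ?S u' v" "shuffle_accepts \<delta> fst_tape F t (n - 1 + k) w" ..
        with Cons \<delta> True show "\<exists>w \<in> ?S u v. shuffle_accepts \<delta> fst_tape F s n w"
          by (intro bexI[of _ "Inl x # w"]) (auto intro: Cons_in_shuffles_leftI)
      qed
      with 1(1)[OF True Cons \<delta>[symmetric]] True Cons \<delta> show ?thesis
        by (subst two_tape_accepts.simps) simp
    qed
  next
    case False
    show ?thesis
    proof (cases v)
      case Nil
      with False show ?thesis
        by (subst two_tape_accepts.simps) (cases u; auto)
    next
      case (Cons x v')
      obtain t k where \<delta>: "\<delta> s (n = 0) x = (t, k)" by force
      have "(\<exists>w \<in> ?S u v. shuffle_accepts \<delta> fst_tape F s n w) \<longleftrightarrow>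
          (\<exists>w \<in> ?S u v'. shuffle_accepts \<delta> fst_tape F t (n - 1 + k) w)"
      proof
        assume "\<exists>w \<in> ?S u v. shuffle_accepts \<delta> fst_tape F s n w"
        then obtain w where w: "w \<in> ?S u v" "shuffle_accepts \<delta> fst_tape F s n w" ..
        then obtain c w' where c: "w = c # w'" using Cons by (cases w) auto
        with w False Cons have "w' \<in> ?S u v'" "c = Inr x"
          by (cases u; auto simp: Cons_in_shuffles_iff)+
        with w c \<delta> show "\<exists>w \<in> ?S u v'. shuffle_accepts \<delta> fst_tape F t (n - 1 + k) w" by auto
      next
        assume "\<exists>w \<in> ?S u v'. shuffle_accepts \<delta> fst_tape F t (n - 1 + k) w"
        then obtain w where "w \<in> ?S u v'" "shuffle_accepts \<delta> fst_tape F t (n - 1 + k) w" ..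
        with Cons \<delta> False show "\<exists>w \<in> ?S u v. shuffle_accepts \<delta> fst_tape F s n w"
          by (intro bexI[of _ "Inr x # w"]) (auto intro: Cons_in_shuffles_rightI)
      qed
      with 1(2)[OF False Cons \<delta>[symmetric]] False Cons \<delta> show ?thesis
        by (subst two_tape_accepts.simps) simp
    qed
  qed
qed

lemma shuffles_map: "shuffles (map f xs) (map f ys) = map f ` shuffles xs ys"
  by (induction xs ys rule: shuffles.induct) (auto simp: image_Un image_image)

lemma pairs_in_image:
  "{(u, v). u \<in> f ` A \<and> v \<in> f ` A \<and> P u v} =
     map_prod f f ` {(u, v). u \<in> A \<and> v \<in> A \<and> P (f u) (f v)}"
  by auto

lemma end_marked_simps [simp]:
  "end_marked [] = [None]"
  "end_marked (x # u) = Some x # end_marked u"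
  by (simp_all add: end_marked_def)

lemma end_marked_map: "end_marked (map e u) = map (map_option e) (end_marked u)"
  by (simp add: end_marked_def)

lemma is_two_tape_language_counter:
  fixes e :: "'c :: finite \<Rightarrow> 'a" and \<delta> :: "('s :: finite, 'c option) counter_delta"
  assumes e: "inj e"
  shows "is_two_tape_language (range e)
    (map_prod (map e) (map e) `
       {(u, v). two_tape_accepts \<delta> fst_tape F s\<^sub>0 0 (end_marked u) (end_marked v)})"
proof -
  let ?e = "map_option e"
  let ?e2 = "map_sum ?e ?e"
  let ?T = "counter_dpda ?e2 (\<lambda>s z x. \<delta> s z (untag x)) F s\<^sub>0"
  let ?S = "\<lambda>b. (to_nat :: 's \<Rightarrow> nat) ` {s. fst_tape s = b}"
  let ?step = "two_tape_step ?T (?S True) (?S False)"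
  have e2: "inj ?e2"
    using e by (simp add: sum.inj_map option.inj_map)
  have S: "to_nat s \<in> ?S b \<longleftrightarrow> fst_tape s = b" for s b
    by auto
  have step: "?step (map ?e2 w, counter_stack n, to_nat s) d \<longleftrightarrow>
     (\<exists>x w' t k. w = x # w' \<and> isl x = fst_tape s \<and> \<delta> s (n = 0) (untag x) = (t, k) \<and>
        d = (map ?e2 w', counter_stack (n - 1 + k), to_nat t))" for w n s d
  proof (cases w)
    case Nil
    then show ?thesis
      using counter_dpda_step[OF e2, of "\<lambda>s z x. \<delta> s z (untag x)" F s\<^sub>0 "[]" n s d]
      by (simp add: two_tape_step_def split: prod.splits)
  next
    case (Cons x w')
    have *: "(\<forall>y. map ?e2 (x # w') = Inl y # map ?e2 w' \<longrightarrow> to_nat s \<in> ?S True) \<and>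
          (\<forall>y. map ?e2 (x # w') = Inr y # map ?e2 w' \<longrightarrow> to_nat s \<in> ?S False) \<longleftrightarrow> isl x = fst_tape s"
      unfolding S by (cases x) auto
    show ?thesis
      unfolding two_tape_step_def Cons
      using counter_dpda_step[OF e2, of "\<lambda>s z x. \<delta> s z (untag x)" F s\<^sub>0 "x # w'" n s d] *
      by (auto split: prod.splits)
  qed
  have acc: "(\<exists>d. ?step\<^sup>*\<^sup>* (map ?e2 w, counter_stack n, to_nat s) d \<and> accepting ?T Final_State d) \<longleftrightarrow>
      shuffle_accepts \<delta> fst_tape F s n w" for w n s
  proof (induction w arbitrary: s n)
    case Nil
    then show ?case
      by (subst rtranclp_accept_iff) (auto simp: step[of "[]", simplified])
  next
    case (Cons x w)
    obtain t k where \<delta>: "\<delta> s (n = 0) (untag x) = (t, k)" by force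
    show ?case
      using Cons.IH[of "n - 1 + k" t] \<delta>
      by (subst rtranclp_accept_iff, subst step) (auto simp del: split_paired_Ex)
  qed
  have shuffle: "is_shuffle (end_marked (map e u)) (end_marked (map e v)) w \<longleftrightarrow>
      (\<exists>w' \<in> shuffles (map Inl (end_marked u)) (map Inr (end_marked v)). w = map ?e2 w')" for u v w
  proof -
    have "map Inl (end_marked (map e u)) = map ?e2 (map Inl (end_marked u))"
      "map Inr (end_marked (map e v)) = map ?e2 (map Inr (end_marked v))"
      by (simp_all add: end_marked_map)
    then show ?thesis
      unfolding is_shuffle_iff by (simp only: shuffles_map) blast
  qed
  have "(\<exists>w d. is_shuffle (end_marked (map e u)) (end_marked (map e v)) w \<and>
        ?step\<^sup>*\<^sup>* (w, [0], to_nat s\<^sub>0) d \<and> accepting ?T Final_State d) \<longleftrightarrow>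
      two_tape_accepts \<delta> fst_tape F s\<^sub>0 0 (end_marked u) (end_marked v)" for u v
    unfolding shuffle two_tape_accepts_iff_shuffle acc[symmetric]
    by (auto simp: counter_stack_def)
  note acceptance = this
  have lang: "two_tape_lang (range e) ?T (?S True) (?S False) Final_State =
     map_prod (map e) (map e) `
       {(u, v). two_tape_accepts \<delta> fst_tape F s\<^sub>0 0 (end_marked u) (end_marked v)}"
    unfolding two_tape_lang_def counter_dpda_simps lists_image lists_UNIV pairs_in_image acceptance by simp
  have "range ?e = insert None (Some ` range e)"
    by (simp add: UNIV_option_conv image_image)
  moreover have "range ?e2 = ?e2 ` (range Inl \<union> range Inr)"
    by (simp flip: Plus_def)
  moreover have "\<dots> = Inl ` range ?e \<union> Inr ` range ?e"
    by (simp only: image_Un image_image map_sum.simps)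
  ultimately have alph: "range ?e2 = two_tape_alph (range e)"
    unfolding two_tape_alph_def Plus_def by simp
  have "is_two_tape_pda (range e) ?T (?S True) (?S False)"
    unfolding is_two_tape_pda_def using is_dpda_counter_dpda alph by auto
  then show ?thesis
    unfolding is_two_tape_language_def using lang by metis
qed

text \<open>
  A membership condition on one tape is a two-tape condition: the tape is read to its end marker,
  the verdict is remembered, and the other tape is read without further checks. Which tape comes
  first is decided by the assignment of states to tapes, so the same transitions serve for both.
\<close>

fun on_tape_delta ::
  "('s, 'c) counter_delta \<Rightarrow> ('s \<Rightarrow> bool) \<Rightarrow> ('s + bool, 'c option) counter_delta" where
  "on_tape_delta \<delta> F (Inl s) z (Some x) = (case \<delta> s z x of (t, k) \<Rightarrow> (Inl t, k))"
| "on_tape_delta \<delta> F (Inl s) z None = (Inr (F s), 0)"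
| "on_tape_delta \<delta> F (Inr b) z x = (Inr b, 0)"

text \<open>
  The recursion equation of \<^const>\<open>two_tape_accepts\<close> is not a terminating rewrite rule; these are
  its instances for words in constructor form.
\<close>

lemma two_tape_accepts_fst:
  "T s \<Longrightarrow> two_tape_accepts \<delta> T F s n [] v \<longleftrightarrow> v = [] \<and> F s"
  "T s \<Longrightarrow> two_tape_accepts \<delta> T F s n (x # u) v \<longleftrightarrow>
     (case \<delta> s (n = 0) x of (t, k) \<Rightarrow> two_tape_accepts \<delta> T F t (n - 1 + k) u v)"
  by (subst two_tape_accepts.simps; simp)+

lemma two_tape_accepts_snd:
  "\<not> T s \<Longrightarrow> two_tape_accepts \<delta> T F s n u [] \<longleftrightarrow> u = [] \<and> F s"
  "\<not> T s \<Longrightarrow> two_tape_accepts \<delta> T F s n u (y # v) \<longleftrightarrow>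
     (case \<delta> s (n = 0) y of (t, k) \<Rightarrow> two_tape_accepts \<delta> T F t (n - 1 + k) u v)"
  by (subst two_tape_accepts.simps; simp)+

lemma two_tape_accepts_on_fst_tape:
  "two_tape_accepts (on_tape_delta \<delta> F) isl (\<lambda>s. s = Inr True) (Inl s) n (end_marked u) v \<longleftrightarrow>
     counter_accepts \<delta> F s n u"
proof -
  have tail: "two_tape_accepts (on_tape_delta \<delta> F) isl (\<lambda>s. s = Inr True) (Inr b) n [] v \<longleftrightarrow> b" for b n v
    by (induction v arbitrary: n) (auto simp: two_tape_accepts_snd)
  show ?thesis
    by (induction u arbitrary: s n)
      (auto simp: two_tape_accepts_fst tail split: prod.splits)
qed

lemma two_tape_accepts_on_snd_tape:
  "two_tape_accepts (on_tape_delta \<delta> F) (\<lambda>s. \<not> isl s) (\<lambda>s. s = Inr True) (Inl s) n u (end_marked v) \<longleftrightarrow>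
     counter_accepts \<delta> F s n v"
proof -
  have tail: "two_tape_accepts (on_tape_delta \<delta> F) (\<lambda>s. \<not> isl s) (\<lambda>s. s = Inr True) (Inr b) n u [] \<longleftrightarrow> b" for b n u
    by (induction u arbitrary: n) (auto simp: two_tape_accepts_fst)
  show ?thesis
    by (induction v arbitrary: s n)
      (auto simp: two_tape_accepts_snd tail split: prod.splits)
qed

section \<open>Comparing the outputs of two transducers\<close>

text \<open>
  A step gives at most one output symbol. This bound is what lets the comparison below get by with
  one remembered symbol.
\<close>

type_synonym ('s, 'c, 'o) mealy = "'s \<Rightarrow> 'c \<Rightarrow> 's \<times> 'o option"

fun mealy_run :: "('s, 'c, 'o) mealy \<Rightarrow> 's \<Rightarrow> 'c list \<Rightarrow> 'o list \<times> 's" where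
  "mealy_run m s [] = ([], s)"
| "mealy_run m s (x # w) = (case m s x of (t, out) \<Rightarrow>
     (case mealy_run m t w of (os, s') \<Rightarrow> (case out of None \<Rightarrow> os | Some y \<Rightarrow> y # os, s')))"

text \<open>
  In \<open>Both\<close> the first tape is read until there is an output symbol, which \<open>Match\<close> then waits for on
  the second tape. The two outputs are thus read in lockstep, however far the input positions drift
  apart.
\<close>

datatype ('s, 't, 'o) compare_state =
  Both 's 't
| Match 's 't 'o
| First_Ended 's 't
| Verdict bool

fun compare_delta :: "('s, 'c, 'o) mealy \<Rightarrow> ('t, 'c, 'o) mealy \<Rightarrow> ('s \<Rightarrow> 't \<Rightarrow> bool) \<Rightarrow>
    (('s, 't, 'o) compare_state, 'c option) counter_delta" where
  "compare_delta f g E (Both s t) z (Some x) =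
     (case f s x of (s', None) \<Rightarrow> Both s' t | (s', Some y) \<Rightarrow> Match s' t y, 0)"
| "compare_delta f g E (Both s t) z None = (First_Ended s t, 0)"
| "compare_delta f g E (Match s t y) z (Some x) =
     (case g t x of (t', None) \<Rightarrow> Match s t' y | (t', Some y') \<Rightarrow> if y' = y then Both s t' else Verdict False, 0)"
| "compare_delta f g E (Match s t y) z None = (Verdict False, 0)"
| "compare_delta f g E (First_Ended s t) z (Some x) =
     (case g t x of (t', None) \<Rightarrow> First_Ended s t' | (t', Some y) \<Rightarrow> Verdict False, 0)"
| "compare_delta f g E (First_Ended s t) z None = (Verdict (E s t), 0)"
| "compare_delta f g E (Verdict b) z x = (Verdict False, 0)"

fun reads_first :: "('s, 't, 'o) compare_state \<Rightarrow> bool" where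
  "reads_first (Both s t) = True"
| "reads_first _ = False"

instance compare_state :: (finite, finite, finite) finite
proof
  have "(UNIV :: ('a, 'b, 'c) compare_state set) =
      case_prod Both ` UNIV \<union> (\<lambda>(s, t, y). Match s t y) ` UNIV \<union>
      case_prod First_Ended ` UNIV \<union> Verdict ` UNIV"
    (is "_ = ?R")
  proof -
    have "x \<in> ?R" for x
    proof (cases x)
      case (Both s t)
      then have "x = case_prod Both (s, t)" by simp
      then show ?thesis by blast
    next
      case (Match s t y)
      then have "x = (\<lambda>(s, t, y). Match s t y) (s, t, y)" by simp
      then show ?thesis by blast
    next
      case (First_Ended s t)
      then have "x = case_prod First_Ended (s, t)" by simp
      then show ?thesis by blast
    qed blast
    then show ?thesis by blast
  qed
  then show "finite (UNIV :: ('a, 'b, 'c) compare_state set)"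
    by (metis finite finite_Un finite_imageI)
qed

text \<open>
  The transitions keep the two outputs equal so far, up to the symbol remembered in \<open>Match\<close>. The
  final states of the transducers, which may hold information not yet output, are compared by \<open>E\<close>
  once both tapes are exhausted.
\<close>

lemma two_tape_accepts_compare:
  "two_tape_accepts (compare_delta f g E) reads_first (\<lambda>s. s = Verdict True) (Both s t) n
     (end_marked u) (end_marked v) \<longleftrightarrow>
   (case (mealy_run f s u, mealy_run g t v) of ((os, s'), (os', t')) \<Rightarrow> os = os' \<and> E s' t')"
proof -
  let ?acc = "two_tape_accepts (compare_delta f g E) reads_first (\<lambda>s. s = Verdict True)"
  have Verdict: "\<not> ?acc (Verdict False) n u v" for n u v
    by (induction v arbitrary: n) (simp_all add: two_tape_accepts_snd)
  have First_Ended: "?acc (First_Ended s t) n [] (end_marked v) \<longleftrightarrow>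
      (case mealy_run g t v of (os, t') \<Rightarrow> os = [] \<and> E s t')" for s t n v
    by (induction v arbitrary: t n)
      (auto simp: two_tape_accepts_snd Verdict split: prod.splits option.splits)
  have Match: "?acc (Match s t y) n (end_marked u) (end_marked v) \<longleftrightarrow>
      (case (mealy_run f s u, mealy_run g t v) of ((os, s'), (os', t')) \<Rightarrow> y # os = os' \<and> E s' t')"
    if Both: "\<And>t n v. ?acc (Both s t) n (end_marked u) (end_marked v) \<longleftrightarrow>
      (case (mealy_run f s u, mealy_run g t v) of ((os, s'), (os', t')) \<Rightarrow> os = os' \<and> E s' t')"
    for s t y n u v
    by (induction v arbitrary: t n)
      (auto simp: two_tape_accepts_snd Verdict Both split: prod.splits option.splits)
  show ?thesis
  proof (induction u arbitrary: s t n v)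
    case Nil
    show ?case
      by (auto simp: two_tape_accepts_fst First_Ended split: prod.splits)
  next
    case (Cons x u)
    show ?case
      by (auto simp: two_tape_accepts_fst Cons.IH
           Match[OF Cons.IH] split: prod.splits option.splits)
  qed
qed

section \<open>Normal forms and their language\<close>

text \<open>
  Directions are \<open>True\<close> for right and \<open>False\<close> for left. \<open>Move d\<close> is a step of the initial power,
  \<open>Cell d b\<close> a step of a sweep in direction \<open>d\<close> that sets one lamp to \<open>b\<close>, and \<open>Back d\<close> a step of the
  way back from that sweep, hence in the direction opposite to \<open>d\<close>.
\<close>

datatype letter = Move bool | Cell bool bool | Back bool

instance letter :: finite
proof
  have "x \<in> range Move \<union> case_prod Cell ` UNIV \<union> range Back" for x
  proof (cases x)
    case (Cell d b)
    then have "x = case_prod Cell (d, b)" by simp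
    then show ?thesis by blast
  qed blast+
  then have "UNIV \<subseteq> range Move \<union> case_prod Cell ` UNIV \<union> range Back" by blast
  then show "finite (UNIV :: letter set)"
    by (rule finite_subset) simp
qed

definition moves :: "int \<Rightarrow> letter list" where
  "moves m = replicate (nat \<bar>m\<bar>) (Move (m \<ge> 0))"

definition side :: "bool \<Rightarrow> bool list \<Rightarrow> letter list" where
  "side d cs = map (Cell d) cs @ replicate (length cs) (Back d)"

definition normal_form :: "int \<Rightarrow> bool list \<Rightarrow> bool list \<Rightarrow> letter list" where
  "normal_form m rs ls = moves m @ side True rs @ side False ls"

text \<open>
  The sweep stops at the last lit lamp; this makes the normal form unique.
\<close>

abbreviation trimmed :: "bool list \<Rightarrow> bool" where
  "trimmed \<equiv> no_trailing Not"

definition normal_forms :: "letter list set" where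
  "normal_forms = {normal_form m rs ls | m rs ls. trimmed rs \<and> trimmed ls}"

text \<open>
  \<open>Cells d b\<close> remembers the last cell because a sweep must not end with an unlit lamp. \<open>Home d\<close> is
  reached when the way back from the sweep in direction \<open>d\<close> is complete.
\<close>

datatype nf_state = Start | Moving bool | Cells bool bool | Backing bool | Home bool | Reject

instance nf_state :: finite
proof
  have "x \<in> {Start, Reject} \<union> range Moving \<union> case_prod Cells ` UNIV \<union> range Backing \<union> range Home" for x
  proof (cases x)
    case (Cells d b)
    then have "x = case_prod Cells (d, b)" by simp
    then show ?thesis by blast
  qed blast+
  then have "UNIV \<subseteq> {Start, Reject} \<union> range Moving \<union> case_prod Cells ` UNIV \<union> range Backing \<union> range Home"
    by blast
  then show "finite (UNIV :: nf_state set)"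
    by (rule finite_subset) simp
qed

text \<open>
  Acceptance by final state needs to know the end of the way back as soon as its last letter is read.
  The counter therefore holds one less than the number of cells: the letter \<open>Back d\<close> that finds it
  zero is the last one. To increase a positive counter by one, 2 is added, since a step also takes
  one away.
\<close>

fun nf_delta :: "(nf_state, letter) counter_delta" where
  "nf_delta Start z (Move d) = (Moving d, 0)"
| "nf_delta Start z (Cell d b) = (Cells d b, 0)"
| "nf_delta (Moving d) z (Move d') = (if d' = d then Moving d else Reject, 0)"
| "nf_delta (Moving d) z (Cell d' b) = (Cells d' b, 0)"
| "nf_delta (Cells d b) z (Cell d' b') = (if d' = d then (Cells d b', if z then 1 else 2) else (Reject, 0))"
| "nf_delta (Cells d b) z (Back d') =
     (if d' = d \<and> b then if z then Home d else Backing d else Reject, 0)"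
| "nf_delta (Backing d) z (Back d') =
     (if d' = d then if z then Home d else Backing d else Reject, 0)"
| "nf_delta (Home True) z (Cell False b) = (Cells False b, 0)"
| "nf_delta _ _ _ = (Reject, 0)"

fun nf_final :: "nf_state \<Rightarrow> bool" where
  "nf_final Start = True"
| "nf_final (Moving d) = True"
| "nf_final (Home d) = True"
| "nf_final _ = False"

abbreviation "nf_accepts \<equiv> counter_accepts nf_delta nf_final"

lemma nf_accepts_Reject: "\<not> nf_accepts Reject n w"
  by (induction w arbitrary: n) auto

lemma nf_accepts_Home_False: "nf_accepts (Home False) n w \<longleftrightarrow> w = []"
  by (cases w) (auto simp: nf_accepts_Reject)

lemma nf_accepts_Backing:
  "nf_accepts (Backing d) n w \<longleftrightarrow>
     (\<exists>w'. w = replicate (Suc n) (Back d) @ w' \<and> nf_accepts (Home d) 0 w')"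
proof (induction w arbitrary: n)
  case (Cons x w)
  then show ?case
    by (cases x; cases n) (auto simp: nf_accepts_Reject)
qed simp

lemma nf_accepts_Cells:
  "nf_accepts (Cells d b) n w \<longleftrightarrow>
     (\<exists>cs w'. trimmed (b # cs) \<and> nf_accepts (Home d) 0 w' \<and>
        w = map (Cell d) cs @ replicate (Suc n + length cs) (Back d) @ w')"
proof (induction w arbitrary: b n)
  case Nil
  then show ?case by simp
next
  case (Cons x w)
  show ?case
  proof (cases x)
    case (Move d')
    then show ?thesis
      by (auto simp: nf_accepts_Reject Cons_eq_append_conv Cons_eq_map_conv)
  next
    case (Cell d' b')
    show ?thesis
    proof
      assume "nf_accepts (Cells d b) n (x # w)"
      with Cell have "d' = d" "nf_accepts (Cells d b') (Suc n) w"
        by (auto simp: nf_accepts_Reject split: if_splits)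
      then obtain cs w' where "trimmed (b' # cs)" "nf_accepts (Home d) 0 w'"
          "w = map (Cell d) cs @ replicate (Suc (Suc n) + length cs) (Back d) @ w'"
        using Cons.IH by blast
      then show "\<exists>cs w'. trimmed (b # cs) \<and> nf_accepts (Home d) 0 w' \<and>
          x # w = map (Cell d) cs @ replicate (Suc n + length cs) (Back d) @ w'"
        using Cell \<open>d' = d\<close> by (intro exI[of _ "b' # cs"] exI[of _ w']) auto
    next
      assume "\<exists>cs w'. trimmed (b # cs) \<and> nf_accepts (Home d) 0 w' \<and>
          x # w = map (Cell d) cs @ replicate (Suc n + length cs) (Back d) @ w'"
      then obtain cs w' where cs: "trimmed (b # cs)" "nf_accepts (Home d) 0 w'"
          "x # w = map (Cell d) cs @ replicate (Suc n + length cs) (Back d) @ w'" by blast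
      then obtain cs' where cs': "cs = b' # cs'" "d' = d" using Cell by (cases cs) auto
      then have "nf_accepts (Cells d b') (Suc n) w"
        unfolding Cons.IH using cs Cell by (intro exI[of _ cs'] exI[of _ w']) auto
      then show "nf_accepts (Cells d b) n (x # w)"
        using Cell cs' by (cases n) auto
    qed
  next
    case (Back d')
    show ?thesis
    proof
      assume "nf_accepts (Cells d b) n (x # w)"
      with Back have b: "d' = d" "b" and "n = 0 \<and> nf_accepts (Home d) 0 w \<or>
          n \<noteq> 0 \<and> nf_accepts (Backing d) (n - 1) w"
        by (auto simp: nf_accepts_Reject split: if_splits)
      then obtain w' where "w = replicate n (Back d) @ w'" "nf_accepts (Home d) 0 w'"
        by (cases n) (auto simp: nf_accepts_Backing)
      then show "\<exists>cs w'. trimmed (b # cs) \<and> nf_accepts (Home d) 0 w' \<and>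
          x # w = map (Cell d) cs @ replicate (Suc n + length cs) (Back d) @ w'"
        using Back b by (intro exI[of _ "[]"] exI[of _ w']) auto
    next
      assume "\<exists>cs w'. trimmed (b # cs) \<and> nf_accepts (Home d) 0 w' \<and>
          x # w = map (Cell d) cs @ replicate (Suc n + length cs) (Back d) @ w'"
      then obtain cs w' where cs: "trimmed (b # cs)" "nf_accepts (Home d) 0 w'"
          "x # w = map (Cell d) cs @ replicate (Suc n + length cs) (Back d) @ w'" by blast
      then have "cs = []" using Back by (cases cs) auto
      with cs Back show "nf_accepts (Cells d b) n (x # w)"
        by (cases n) (auto simp: nf_accepts_Backing)
    qed
  qed
qed

lemma side_simps [simp]:
  "side d [] = []"
  "side d (b # cs) = Cell d b # map (Cell d) cs @ replicate (Suc (length cs)) (Back d)"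
  by (simp_all add: side_def)

lemma nf_accepts_Cells_0:
  "nf_accepts (Cells d b) 0 w \<longleftrightarrow>
     (\<exists>cs w'. trimmed (b # cs) \<and> nf_accepts (Home d) 0 w' \<and> Cell d b # w = side d (b # cs) @ w')"
  unfolding nf_accepts_Cells by simp

lemma nf_accepts_Home_True:
  "nf_accepts (Home True) 0 w \<longleftrightarrow> (\<exists>ls. trimmed ls \<and> w = side False ls)"
proof (cases w)
  case Nil
  then show ?thesis by (auto intro: exI[of _ "[]"])
next
  case (Cons x w')
  show ?thesis
  proof (cases "\<exists>b. x = Cell False b")
    case True
    then obtain b where x: "x = Cell False b" ..
    have "nf_accepts (Home True) 0 w \<longleftrightarrow> nf_accepts (Cells False b) 0 w'"
      by (simp add: Cons x)
    also have "\<dots> \<longleftrightarrow> (\<exists>cs. trimmed (b # cs) \<and> w = side False (b # cs))"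
      unfolding nf_accepts_Cells_0 nf_accepts_Home_False Cons x by auto
    also have "\<dots> \<longleftrightarrow> (\<exists>ls. trimmed ls \<and> w = side False ls)"
    proof safe
      fix ls assume "trimmed ls" "w = side False ls"
      then show "\<exists>cs. trimmed (b # cs) \<and> side False ls = side False (b # cs)"
        using Cons x by (cases ls) auto
    qed blast
    finally show ?thesis .
  next
    case False
    then have "nf_delta (Home True) True x = (Reject, 0)"
      by (cases x rule: letter.exhaust) (metis (full_types) nf_delta.simps)+
    moreover have "w \<noteq> side False ls" for ls
      using False Cons by (cases ls) auto
    ultimately show ?thesis
      by (simp add: Cons nf_accepts_Reject)
  qed
qed

text \<open>
  What may follow the initial power.
\<close>

definition cells_word :: "letter list \<Rightarrow> bool" where
  "cells_word w \<longleftrightarrow> (\<exists>rs ls. trimmed rs \<and> trimmed ls \<and> w = side True rs @ side False ls)"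

lemma cells_word_Nil: "cells_word []"
  unfolding cells_word_def by (intro exI[of _ "[]"]) simp

lemma not_cells_word: "\<not> cells_word (Move d # w)" "\<not> cells_word (Back d # w)"
proof -
  have "side True rs @ side False ls \<noteq> Move d # w" "side True rs @ side False ls \<noteq> Back d # w" for rs ls
    by (cases rs; cases ls; simp)+
  then show "\<not> cells_word (Move d # w)" "\<not> cells_word (Back d # w)"
    unfolding cells_word_def by metis+
qed

lemma nf_accepts_cells_word: "nf_accepts (Cells d b) 0 w \<longleftrightarrow> cells_word (Cell d b # w)"
proof (cases d)
  case True
  have "nf_accepts (Cells d b) 0 w \<longleftrightarrow>
      (\<exists>cs ls. trimmed (b # cs) \<and> trimmed ls \<and> Cell d b # w = side True (b # cs) @ side False ls)"
    unfolding nf_accepts_Cells_0 using True by (auto simp: nf_accepts_Home_True)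
  also have "\<dots> \<longleftrightarrow> cells_word (Cell d b # w)"
    unfolding cells_word_def
  proof
    assume "\<exists>rs ls. trimmed rs \<and> trimmed ls \<and> Cell d b # w = side True rs @ side False ls"
    then obtain rs ls where *: "trimmed rs" "trimmed ls" "Cell d b # w = side True rs @ side False ls"
      by blast
    then obtain cs where "rs = b # cs" using True by (cases rs; cases ls) auto
    with * show "\<exists>cs ls. trimmed (b # cs) \<and> trimmed ls \<and> Cell d b # w = side True (b # cs) @ side False ls"
      by blast
  qed blast
  finally show ?thesis .
next
  case False
  have "nf_accepts (Cells d b) 0 w \<longleftrightarrow> (\<exists>cs. trimmed (b # cs) \<and> Cell d b # w = side False (b # cs))"
    unfolding nf_accepts_Cells_0 using False by (auto simp: nf_accepts_Home_False)
  also have "\<dots> \<longleftrightarrow> cells_word (Cell d b # w)"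
    unfolding cells_word_def
  proof
    assume "\<exists>rs ls. trimmed rs \<and> trimmed ls \<and> Cell d b # w = side True rs @ side False ls"
    then obtain rs ls where *: "trimmed rs" "trimmed ls" "Cell d b # w = side True rs @ side False ls"
      by blast
    then have "rs = []" using False by (cases rs) auto
    with * obtain cs where "ls = b # cs" using False by (cases ls) auto
    with * \<open>rs = []\<close> show "\<exists>cs. trimmed (b # cs) \<and> Cell d b # w = side False (b # cs)"
      by auto
  next
    assume "\<exists>cs. trimmed (b # cs) \<and> Cell d b # w = side False (b # cs)"
    then obtain cs where "trimmed (b # cs)" "Cell d b # w = side True [] @ side False (b # cs)" by auto
    then show "\<exists>rs ls. trimmed rs \<and> trimmed ls \<and> Cell d b # w = side True rs @ side False ls"
      by (metis no_trailing_Nil)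
  qed
  finally show ?thesis .
qed

lemma nf_accepts_Moving:
  "nf_accepts (Moving d) 0 w \<longleftrightarrow> (\<exists>k w'. w = replicate k (Move d) @ w' \<and> cells_word w')"
proof (induction w)
  case Nil
  then show ?case by (auto simp: cells_word_Nil)
next
  case (Cons x w)
  have split: "(\<exists>k w'. x # w = replicate k (Move d) @ w' \<and> cells_word w') \<longleftrightarrow>
      cells_word (x # w) \<or> x = Move d \<and> (\<exists>k w'. w = replicate k (Move d) @ w' \<and> cells_word w')"
    (is "?l \<longleftrightarrow> ?r")
  proof
    assume ?l
    then obtain k w' where "x # w = replicate k (Move d) @ w'" "cells_word w'" by blast
    then show ?r by (cases k) auto
  next
    assume ?r
    then show ?l
    proof (elim disjE conjE exE)
      fix k w' assume "x = Move d" "w = replicate k (Move d) @ w'" "cells_word w'"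
      then show ?l by (intro exI[of _ "Suc k"] exI[of _ w']) simp
    qed (metis append_Nil replicate_0)
  qed
  show ?case
    unfolding split by (cases x) (auto simp: Cons.IH nf_accepts_cells_word not_cells_word nf_accepts_Reject)
qed

lemma nf_accepts_iff: "nf_accepts Start 0 w \<longleftrightarrow> w \<in> normal_forms"
proof -
  have "w \<in> normal_forms \<longleftrightarrow> (\<exists>m w'. w = moves m @ w' \<and> cells_word w')"
    unfolding normal_forms_def normal_form_def cells_word_def by blast
  also have "\<dots> \<longleftrightarrow> (\<exists>d k w'. w = replicate k (Move d) @ w' \<and> cells_word w')"
  proof safe
    fix d k w'
    have "replicate k (Move d) = moves (if d then int k else - int k)"
      by (cases k) (auto simp: moves_def nat_add_distrib)
    then show "\<exists>m w''. replicate k (Move d) @ w' = moves m @ w'' \<and> cells_word w''"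
      if "cells_word w'" using that by auto
  qed (auto simp: moves_def)
  also have "\<dots> \<longleftrightarrow> nf_accepts Start 0 w"
  proof (cases w)
    case Nil
    then show ?thesis using cells_word_Nil by auto
  next
    case (Cons x w')
    have "(\<exists>d k w'. w = replicate k (Move d) @ w' \<and> cells_word w') \<longleftrightarrow> (\<exists>d. nf_accepts (Moving d) 0 w)"
      by (simp add: nf_accepts_Moving)
    also have "\<dots> \<longleftrightarrow> nf_accepts Start 0 w"
      by (cases x) (auto simp: Cons nf_accepts_Reject split: if_splits)
    finally show ?thesis .
  qed
  finally show ?thesis by blast
qed

section \<open>Values of normal forms\<close>

text \<open>
  \<open>gen True c\<close> is \<open>t\<close>, preceded by the switch \<open>a\<close> if \<open>c\<close> holds; the switched lamp lies to the left of the
  new position. \<open>gen False c\<close> is the inverse of \<open>gen True c\<close>: a step to the left, followed by \<open>a\<close> if \<open>c\<close>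
  holds.
\<close>

definition gen :: "bool \<Rightarrow> bool \<Rightarrow> int \<times> (int \<Rightarrow> bool)" where
  "gen d c = (if d then (1, \<lambda>i. c \<and> i = - 1) else (- 1, \<lambda>i. c \<and> i = 0))"

fun letter_value :: "letter \<Rightarrow> int \<times> (int \<Rightarrow> bool)" where
  "letter_value (Move d) = gen d False"
| "letter_value (Cell d b) = gen d b"
| "letter_value (Back d) = gen (\<not> d) False"

definition nf_value :: "int \<Rightarrow> bool list \<Rightarrow> bool list \<Rightarrow> int \<times> (int \<Rightarrow> bool)" where
  "nf_value m rs ls =
     (m, \<lambda>i. if i \<ge> 0 then nth_default False rs (nat i) else nth_default False ls (nat (- 1 - i)))"

lemma gen_closed: "gen d c \<in> carrier lamplighter"
  by (simp add: gen_def)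

lemma letter_value_closed: "letter_value x \<in> carrier lamplighter"
  by (cases x) (simp_all add: gen_closed)

lemma gen_inverse: "gen d c \<otimes>\<^bsub>lamplighter\<^esub> gen (\<not> d) c = \<one>\<^bsub>lamplighter\<^esub>"
  by (auto simp: gen_def)

lemma (in monoid) word_value_closed:
  "(\<And>x. \<phi> x \<in> carrier G) \<Longrightarrow> word_value G \<phi> w \<in> carrier G"
  by (induction w) (simp_all add: word_value_def)

lemma (in monoid) word_value_append:
  assumes "\<And>x. \<phi> x \<in> carrier G"
  shows "word_value G \<phi> (u @ v) = word_value G \<phi> u \<otimes> word_value G \<phi> v"
proof (induction u)
  case Nil
  show ?case using word_value_closed[of \<phi> v, OF assms] by (simp add: word_value_def)
next
  case (Cons x u)
  have "word_value G \<phi> (x # w) = \<phi> x \<otimes> word_value G \<phi> w" for w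
    by (simp add: word_value_def)
  then show ?case
    using assms word_value_closed[of \<phi>, OF assms] by (simp add: Cons m_assoc)
qed

abbreviation "lval \<equiv> word_value lamplighter letter_value"

lemmas lval_append = lamplighter.word_value_append[of letter_value, OF letter_value_closed]

lemma lval_Cons: "lval (x # w) = letter_value x \<otimes>\<^bsub>lamplighter\<^esub> lval w"
  by (simp add: word_value_def)

lemma lval_Nil: "lval [] = (0, \<lambda>_. False)"
  by (simp add: word_value_def)

lemma lval_moves: "lval (moves m) = nf_value m [] []"
proof -
  have "lval (replicate k (Move d)) = (if d then int k else - int k, \<lambda>_. False)" for k d
    by (induction k) (auto simp: lval_Cons lval_Nil gen_def)
  then show ?thesis by (auto simp: moves_def nf_value_def)
qed

lemma side_Cons: "side d (b # cs) = Cell d b # side d cs @ [Back d]"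
  by (simp add: side_def replicate_append_same)

text \<open>
  By induction from the outside: conjugation by a step moves all lamps set by the inner part one
  further away, which leaves room for the new cell next to the origin.
\<close>

lemma lval_side: "lval (side d cs) = (if d then nf_value 0 cs [] else nf_value 0 [] cs)"
proof (induction cs)
  case Nil
  show ?case by (simp add: lval_Nil nf_value_def)
next
  case (Cons b cs)
  have conj: "lval (side d (b # cs)) =
      gen d b \<otimes>\<^bsub>lamplighter\<^esub> ((if d then nf_value 0 cs [] else nf_value 0 [] cs) \<otimes>\<^bsub>lamplighter\<^esub> gen (\<not> d) False)"
    unfolding side_Cons lval_Cons lval_append Cons.IH
    by (simp add: lval_Nil gen_def del: side_simps)
  have right: "nth_default False (b # cs) (nat i) =
      (if i = 0 then b else nth_default False cs (nat (i - 1)))" if "i \<ge> 0" for i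
  proof (cases "i = 0")
    case False
    with that have "nat i = Suc (nat (i - 1))" by simp
    with False show ?thesis by simp
  qed simp
  have left: "nth_default False (b # cs) (nat (- 1 - i)) =
      (if i = - 1 then b else nth_default False cs (nat (- 2 - i)))" if "i < 0" for i
  proof (cases "i = - 1")
    case False
    with that have "nat (- 1 - i) = Suc (nat (- 2 - i))" by simp
    with False show ?thesis by simp
  qed simp
  show ?case
    unfolding conj
    by (auto simp: nf_value_def gen_def right left fun_eq_iff)
qed

lemma lval_normal_form: "lval (normal_form m rs ls) = nf_value m rs ls"
  unfolding normal_form_def lval_append lval_moves lval_side
  by (auto simp: nf_value_def)

lemma trimmed_eq_iff:
  assumes "trimmed xs" "trimmed ys"
  shows "xs = ys \<longleftrightarrow> (\<forall>i. nth_default False xs i = nth_default False ys i)"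
proof -
  have "strip_while (HOL.eq False) = strip_while Not"
    by (rule arg_cong[of _ _ strip_while]) (simp add: fun_eq_iff)
  then show ?thesis
    using nth_default_eq_iff[of False xs ys] assms by (simp add: fun_eq_iff)
qed

text \<open>
  The lamps with non-negative offset \<open>i\<close> are in the right sweep, those with offset \<open>- 1 - i\<close> in the left
  one.
\<close>

lemma nf_value_eq_iff_nth:
  "nf_value m rs ls = (m', T) \<longleftrightarrow> m = m' \<and>
     (\<forall>i. nth_default False rs i = T (int i)) \<and> (\<forall>i. nth_default False ls i = T (- 1 - int i))"
proof -
  have *: "(\<forall>i. P i) \<longleftrightarrow> (\<forall>i. P (int i)) \<and> (\<forall>i. P (- 1 - int i))" for P
  proof safe
    fix i assume "\<forall>i. P (int i)" "\<forall>i. P (- 1 - int i)"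
    moreover have "i = int (nat i) \<or> i = - 1 - int (nat (- 1 - i))" by arith
    ultimately show "P i" by metis
  qed auto
  show ?thesis
    unfolding nf_value_def prod.inject fun_eq_iff
    by (subst *) auto
qed

lemma nf_value_inj:
  assumes "trimmed rs" "trimmed ls" "trimmed rs'" "trimmed ls'"
  shows "nf_value m rs ls = nf_value m' rs' ls' \<longleftrightarrow> m = m' \<and> rs = rs' \<and> ls = ls'"
proof -
  obtain T where T: "nf_value m' rs' ls' = (m', T)" by (simp add: nf_value_def)
  then show ?thesis
    using nf_value_eq_iff_nth[of m' rs' ls' m' T] nf_value_eq_iff_nth[of m rs ls m' T]
    by (auto simp: trimmed_eq_iff assms)
qed

lemma trimmed_list_exists:
  assumes "finite {i. f i}"
  obtains xs where "trimmed xs" "\<And>i. nth_default False xs i = f i"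
proof -
  obtain N where N: "\<And>i. f i \<Longrightarrow> i < N"
    using assms by (metis finite_nat_set_iff_bounded mem_Collect_eq)
  have "(HOL.eq False) = Not" by (simp add: fun_eq_iff)
  then have "nth_default False (strip_while Not (map f [0..<N])) = nth_default False (map f [0..<N])"
    by (metis nth_default_eq_iff no_trailing_strip_while strip_while_idem)
  moreover have "nth_default False (map f [0..<N]) i = f i" for i
    using N by (auto simp: nth_default_def)
  ultimately show ?thesis
    by (intro that[of "strip_while Not (map f [0..<N])"]) auto
qed

lemma bij_betw_normal_forms: "bij_betw lval normal_forms (carrier lamplighter)"
  unfolding bij_betw_def
proof
  show "inj_on lval normal_forms"
    by (auto simp: inj_on_def normal_forms_def lval_normal_form nf_value_inj)
  show "lval ` normal_forms = carrier lamplighter"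
  proof
    show "lval ` normal_forms \<subseteq> carrier lamplighter"
      using lamplighter.word_value_closed[of letter_value, OF letter_value_closed] by blast
    show "carrier lamplighter \<subseteq> lval ` normal_forms"
    proof
      fix g assume g: "g \<in> carrier lamplighter"
      obtain m T where mT: "g = (m, T)" by force
      then have T: "finite {i. T i}" using g by simp
      have "finite {i. T (int i)}"
        using finite_vimageI[OF T, of int] by (simp add: vimage_def)
      then obtain rs where rs: "trimmed rs" "\<And>i. nth_default False rs i = T (int i)"
        by (rule trimmed_list_exists) blast
      have "finite {i. T (- 1 - int i)}"
        using finite_vimageI[OF T, of "\<lambda>i. - 1 - int i"] by (simp add: vimage_def inj_def)
      then obtain ls where ls: "trimmed ls" "\<And>i. nth_default False ls i = T (- 1 - int i)"
        by (rule trimmed_list_exists) blast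
      have "lval (normal_form m rs ls) = g"
        unfolding lval_normal_form mT nf_value_eq_iff_nth using rs ls by simp
      then show "g \<in> lval ` normal_forms"
        using rs ls unfolding normal_forms_def by blast
    qed
  qed
qed

text \<open>
  When an unlit lamp enters an empty left sweep, the sweep remains empty, as it must stay trimmed.
  Padding makes this case look like the others, and loses nothing since \<open>[False]\<close> is not trimmed.
\<close>

definition pad :: "bool list \<Rightarrow> bool list" where
  "pad ls = (if ls = [] then [False] else ls)"

lemma pad_eq_Cons_iff:
  assumes "trimmed ls" "trimmed ls'"
  shows "pad ls' = c # ls \<longleftrightarrow> (\<forall>i. nth_default False ls' i = nth_default False (c # ls) i)"
proof (cases "trimmed (c # ls)")
  case True
  then show ?thesis
    using trimmed_eq_iff[OF assms(2) True] by (auto simp: pad_def)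
next
  case False
  with assms(1) have cls: "c = False" "ls = []" by auto
  have "ls' = [] \<longleftrightarrow> (\<forall>i. nth_default False ls' i = False)"
    using trimmed_eq_iff[OF assms(2), of "[]"] by simp
  moreover have "nth_default False [False] i = False" for i by (cases i) auto
  moreover have "ls' \<noteq> [False]" using assms(2) by auto
  ultimately show ?thesis by (auto simp: cls pad_def)
qed

text \<open>
  A step to the right decreases all relative offsets by one, so the only lamp to change sides is the
  one at the old position, which is the one that \<open>c\<close> may switch.
\<close>

lemma nf_value_shift:
  assumes "trimmed rs" "trimmed ls" "trimmed rs'" "trimmed ls'"
  shows "nf_value m' rs' ls' = nf_value m rs ls \<otimes>\<^bsub>lamplighter\<^esub> gen True c \<longleftrightarrow>
     m' = m + 1 \<and> rs' = tl rs \<and> pad ls' = (nth_default False rs 0 \<noteq> c) # ls"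
proof -
  obtain T where T: "nf_value m rs ls = (m, T)" by (simp add: nf_value_def)
  then have nth: "T (int i) = nth_default False rs i" "T (- 1 - int i) = nth_default False ls i" for i
    using nf_value_eq_iff_nth[of m rs ls m T] by auto
  have tl: "nth_default False (tl rs) i = nth_default False rs (Suc i)" for i
    by (cases rs) auto
  have "trimmed (tl rs)" using assms(1) by (cases rs) auto
  have 1: "rs' = tl rs \<longleftrightarrow> (\<forall>i. nth_default False rs' i = T (int i + 1))"
    unfolding trimmed_eq_iff[OF assms(3) \<open>trimmed (tl rs)\<close>] tl
    using nth(1)[of "Suc _"] by (simp add: add.commute)
  have "nth_default False ((nth_default False rs 0 \<noteq> c) # ls) i \<longleftrightarrow> T (- 1 - int i + 1) \<noteq> (c \<and> i = 0)" for i
    using nth(1)[of 0] nth(2) by (cases i) (auto simp: algebra_simps)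
  then have 2: "pad ls' = (nth_default False rs 0 \<noteq> c) # ls \<longleftrightarrow>
      (\<forall>i. nth_default False ls' i = (T (- 1 - int i + 1) \<noteq> (c \<and> i = 0)))"
    unfolding pad_eq_Cons_iff[OF assms(2,4)] by simp
  show ?thesis
    unfolding T 1 2 gen_def by (auto simp: nf_value_eq_iff_nth)
qed

section \<open>Right multiplication by a letter\<close>

lemma mealy_run_append:
  "mealy_run f s (u @ v) =
     (case mealy_run f s u of (os, t) \<Rightarrow> case mealy_run f t v of (os', t') \<Rightarrow> (os @ os', t'))"
  by (induction u arbitrary: s) (auto split: prod.splits option.splits)

lemma mealy_run_silent:
  "(\<And>x. x \<in> set w \<Longrightarrow> f s x = (s, None)) \<Longrightarrow> mealy_run f s w = ([], s)"
  by (induction w) auto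

text \<open>
  An integer is compared by means of its sign, held in the final state, and a unary number. The
  states are \<open>m \<ge> 0\<close> for \<open>num_succ\<close> and \<open>m > 0\<close> for \<open>num_id\<close>, where \<open>m\<close> is the exponent read so
  far; one \<open>Move\<close> of the sign for which zero does not count remains without output. The results
  are the same for \<open>m\<close> under \<open>num_succ\<close> as for \<open>m + 1\<close> under \<open>num_id\<close>.
\<close>

fun num_succ :: "(bool, letter, unit) mealy" where
  "num_succ s (Move True) = (s, Some ())"
| "num_succ s (Move False) = (False, if s then None else Some ())"
| "num_succ s _ = (s, None)"

fun num_id :: "(bool, letter, unit) mealy" where
  "num_id s (Move True) = (True, if s then Some () else None)"
| "num_id s (Move False) = (s, Some ())"
| "num_id s _ = (s, None)"

fun right_tl :: "(bool, letter, bool) mealy" where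
  "right_tl s (Cell True b) = (True, if s then Some b else None)"
| "right_tl s _ = (s, None)"

fun right_id :: "(unit, letter, bool) mealy" where
  "right_id s (Cell True b) = (s, Some b)"
| "right_id s _ = (s, None)"

text \<open>
  The output is delayed by one symbol, the second component of the state. In \<open>left_Cons\<close> this makes
  room for the additional first symbol with only one output per letter, and in \<open>left_pad\<close> it
  supplies the padding symbol of an empty list. The last symbol stays in the final state. Starting
  \<open>left_Cons\<close> with the symbol \<open>c\<close> gives the right answer also if there are no cells to the right.
\<close>

fun left_Cons :: "(bool \<times> bool, letter, bool) mealy" where
  "left_Cons (seen, p) (Cell True b) = ((True, if seen then p else b \<noteq> p), None)"
| "left_Cons (seen, p) (Cell False b) = ((seen, b), Some p)"
| "left_Cons s _ = (s, None)"

fun left_pad :: "(bool \<times> bool, letter, bool) mealy" where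
  "left_pad (seen, p) (Cell False b) = ((True, b), if seen then Some p else None)"
| "left_pad s _ = (s, None)"

lemma set_normal_form_parts:
  "x \<in> set (moves m) \<Longrightarrow> \<exists>d. x = Move d"
  "x \<in> set (side d cs) \<Longrightarrow> (\<exists>b. x = Cell d b) \<or> x = Back d"
  by (auto simp: moves_def side_def)

lemma mealy_run_num_succ:
  "mealy_run num_succ True (normal_form m rs ls) =
     (replicate (if m \<ge> 0 then nat m else nat (- m - 1)) (), m \<ge> 0)"
proof -
  have 1: "mealy_run num_succ s (replicate k (Move True)) = (replicate k (), s)" for s k
    by (induction k) auto
  have 2: "mealy_run num_succ False (replicate k (Move False)) = (replicate k (), False)" for k
    by (induction k) auto
  have 3: "mealy_run num_succ True (replicate k (Move False)) = (replicate (k - 1) (), k = 0)" for k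
    by (cases k) (auto simp: 2)
  have "mealy_run num_succ s (side True rs @ side False ls) = ([], s)" for s
    by (rule mealy_run_silent) (auto dest: set_normal_form_parts)
  then show ?thesis
    by (auto simp: normal_form_def moves_def mealy_run_append 1 3 nat_diff_distrib' split: prod.splits)
qed

lemma mealy_run_num_id:
  "mealy_run num_id False (normal_form m rs ls) =
     (replicate (if m > 0 then nat (m - 1) else nat (- m)) (), m > 0)"
proof -
  have 1: "mealy_run num_id s (replicate k (Move False)) = (replicate k (), s)" for s k
    by (induction k) auto
  have 2: "mealy_run num_id True (replicate k (Move True)) = (replicate k (), True)" for k
    by (induction k) auto
  have 3: "mealy_run num_id False (replicate k (Move True)) = (replicate (k - 1) (), k > 0)" for k
    by (cases k) (auto simp: 2)
  have "mealy_run num_id s (side True rs @ side False ls) = ([], s)" for s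
    by (rule mealy_run_silent) (auto dest: set_normal_form_parts)
  then show ?thesis
    by (cases "m = 0") (auto simp: normal_form_def moves_def mealy_run_append 1 3 nat_diff_distrib' split: prod.splits)
qed

lemma mealy_run_right_tl:
  "fst (mealy_run right_tl False (normal_form m rs ls)) = tl rs"
proof -
  have 1: "mealy_run right_tl True (map (Cell True) cs) = (cs, True)" for cs
    by (induction cs) auto
  have 2: "mealy_run right_tl False (map (Cell True) cs) = (tl cs, cs \<noteq> [])" for cs
    by (cases cs) (auto simp: 1)
  have 3: "mealy_run right_tl s (replicate k (Back True) @ side False ls) = ([], s)" for s k
    by (rule mealy_run_silent) (auto dest: set_normal_form_parts)
  have 4: "mealy_run right_tl s (moves m) = ([], s)" for s
    by (rule mealy_run_silent) (auto dest: set_normal_form_parts)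
  show ?thesis
    unfolding normal_form_def side_def[of True] append_assoc mealy_run_append[of _ _ "moves _"] 4
      mealy_run_append[of _ _ "map _ _"] by (simp add: 2 3)
qed

lemma mealy_run_right_id:
  "fst (mealy_run right_id () (normal_form m rs ls)) = rs"
proof -
  have 2: "mealy_run right_id s (map (Cell True) cs) = (cs, s)" for s cs
    by (induction cs) auto
  have 3: "mealy_run right_id s (replicate k (Back True) @ side False ls) = ([], s)" for s k
    by (rule mealy_run_silent) (auto dest: set_normal_form_parts)
  have 4: "mealy_run right_id s (moves m) = ([], s)" for s
    by (rule mealy_run_silent) (auto dest: set_normal_form_parts)
  show ?thesis
    unfolding normal_form_def side_def[of True] append_assoc mealy_run_append[of _ _ "moves _"] 4
      mealy_run_append[of _ _ "map _ _"] by (simp add: 2 3)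
qed

lemma mealy_run_left_Cons:
  "case mealy_run left_Cons (False, c) (normal_form m rs ls) of
     (os, (seen, p)) \<Rightarrow> os @ [p] = (nth_default False rs 0 \<noteq> c) # ls"
proof -
  have 1: "mealy_run left_Cons (True, p) (map (Cell True) cs) = ([], (True, p))" for p cs
    by (rule mealy_run_silent) auto
  have 2: "mealy_run left_Cons (False, c) (map (Cell True) rs) =
      ([], (rs \<noteq> [], nth_default False rs 0 \<noteq> c))"
    by (cases rs) (auto simp: 1)
  have 3: "mealy_run left_Cons s (moves m) = ([], s)" for s
    by (rule mealy_run_silent) (auto dest: set_normal_form_parts)
  have 4: "mealy_run left_Cons s (replicate k (Back d)) = ([], s)" for s k d
    by (rule mealy_run_silent) auto
  have 5: "mealy_run left_Cons (seen, p) (map (Cell False) ls) =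
      (butlast (p # ls), (seen, last (p # ls)))" for seen p
    by (induction ls arbitrary: p) auto
  show ?thesis
    unfolding normal_form_def side_def mealy_run_append 2 3 4 5 by (simp add: 2 3 4 5)
qed

lemma mealy_run_left_pad:
  "case mealy_run left_pad (False, False) (normal_form m rs ls) of (os, (seen, p)) \<Rightarrow> os @ [p] = pad ls"
proof -
  have 1: "mealy_run left_pad s (moves m @ side True rs) = ([], s)" for s
    by (rule mealy_run_silent) (auto dest: set_normal_form_parts)
  have 4: "mealy_run left_pad s (replicate k (Back d)) = ([], s)" for s k d
    by (rule mealy_run_silent) auto
  have 5: "mealy_run left_pad (True, p) (map (Cell False) cs) =
      (butlast (p # cs), (True, last (p # cs)))" for p cs
    by (induction cs arbitrary: p) auto
  have 6: "mealy_run left_pad (False, False) (map (Cell False) ls) =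
      (butlast (pad ls), (ls \<noteq> [], last (pad ls)))"
    by (cases ls) (auto simp: 5 pad_def)
  show ?thesis
    unfolding normal_form_def append_assoc[symmetric] mealy_run_append[of _ _ "_ @ _"] 1
    by (simp add: side_def mealy_run_append 4 6) (simp add: pad_def)
qed

definition mealy_equal ::
  "('s, 'c, 'o) mealy \<Rightarrow> 's \<Rightarrow> ('t, 'c, 'o) mealy \<Rightarrow> 't \<Rightarrow> ('s \<Rightarrow> 't \<Rightarrow> bool) \<Rightarrow> ('c list \<times> 'c list) set" where
  "mealy_equal f s g t E = {(u, v).
     case (mealy_run f s u, mealy_run g t v) of ((os, s'), (os', t')) \<Rightarrow> os = os' \<and> E s' t'}"

lemma converse_mealy_equal: "(mealy_equal f s g t E)\<inverse> = mealy_equal g t f s (\<lambda>t s. E s t)"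
  by (auto simp: mealy_equal_def split: prod.splits)

text \<open>
  The three relations express the three parts of \<open>nf_value_shift\<close>.
\<close>

lemma mult_gen_iff:
  assumes "u \<in> normal_forms" "v \<in> normal_forms"
  shows "lval v = lval u \<otimes>\<^bsub>lamplighter\<^esub> gen True c \<longleftrightarrow>
     (u, v) \<in> mealy_equal num_succ True num_id False (=)
        \<inter> mealy_equal right_tl False right_id () (\<lambda>_ _. True)
        \<inter> mealy_equal left_Cons (False, c) left_pad (False, False) (\<lambda>s t. snd s = snd t)"
proof -
  obtain m rs ls where u: "u = normal_form m rs ls" "trimmed rs" "trimmed ls"
    using assms(1) unfolding normal_forms_def by blast
  obtain m' rs' ls' where v: "v = normal_form m' rs' ls'" "trimmed rs'" "trimmed ls'"
    using assms(2) unfolding normal_forms_def by blast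
  have "m' = m + 1 \<longleftrightarrow> (u, v) \<in> mealy_equal num_succ True num_id False (=)"
    unfolding u v mealy_equal_def by (auto simp: mealy_run_num_succ mealy_run_num_id)
  moreover have "rs' = tl rs \<longleftrightarrow> (u, v) \<in> mealy_equal right_tl False right_id () (\<lambda>_ _. True)"
    using mealy_run_right_tl[of m rs ls] mealy_run_right_id[of m' rs' ls']
    unfolding u v mealy_equal_def by (auto split: prod.splits)
  moreover have "pad ls' = (nth_default False rs 0 \<noteq> c) # ls \<longleftrightarrow>
      (u, v) \<in> mealy_equal left_Cons (False, c) left_pad (False, False) (\<lambda>s t. snd s = snd t)"
  proof -
    obtain os s p os' s' p' where
      runs: "mealy_run left_Cons (False, c) u = (os, (s, p))"
        "mealy_run left_pad (False, False) v = (os', (s', p'))"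
      by (metis surj_pair)
    then have "os @ [p] = (nth_default False rs 0 \<noteq> c) # ls" "os' @ [p'] = pad ls'"
      using mealy_run_left_Cons[where m = m and rs = rs and ls = ls and c = c]
        mealy_run_left_pad[where m = m' and rs = rs' and ls = ls'] u v by auto
    then have "pad ls' = (nth_default False rs 0 \<noteq> c) # ls \<longleftrightarrow> os @ [p] = os' @ [p']"
      by metis
    then show ?thesis using runs by (auto simp: mealy_equal_def)
  qed
  ultimately show ?thesis
    unfolding u(1) v(1) lval_normal_form nf_value_shift[OF u(2,3) v(2,3)] by blast
qed

lemma mult_gen_False_iff:
  assumes "u \<in> normal_forms" "v \<in> normal_forms"
  shows "lval v = lval u \<otimes>\<^bsub>lamplighter\<^esub> gen False c \<longleftrightarrow> lval u = lval v \<otimes>\<^bsub>lamplighter\<^esub> gen True c"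
proof -
  have closed: "lval w \<in> carrier lamplighter" for w
    by (rule lamplighter.word_value_closed[of letter_value, OF letter_value_closed])
  have "gen False c = inv\<^bsub>lamplighter\<^esub> gen True c"
    using gen_inverse[of True c] lamplighter.inv_equality[of "gen False c" "gen True c"]
      gen_inverse[of False c] gen_closed by simp
  then show ?thesis
    using lamplighter.inv_solve_right[OF closed[of v] closed[of u] gen_closed[of True c]] by metis
qed

section \<open>The parallel poly-pushdown structure\<close>

text \<open>
  The alphabet of a structure consists of numbers, whereas the letters here form an abstract finite
  type; \<^const>\<open>to_nat\<close> mediates between them.
\<close>

definition two_tape_regular :: "('c :: finite list \<times> 'c list) set \<Rightarrow> bool" where
  "two_tape_regular R \<longleftrightarrow>
     is_two_tape_language (range (to_nat :: 'c \<Rightarrow> nat)) (map_prod (map to_nat) (map to_nat) ` R)"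

lemma two_tape_regular_mealy_equal:
  fixes f :: "('s :: finite, 'c :: finite, 'o :: finite) mealy" and g :: "('t :: finite, 'c, 'o) mealy"
  shows "two_tape_regular (mealy_equal f s g t E)"
  unfolding two_tape_regular_def mealy_equal_def
  using is_two_tape_language_counter[of to_nat "compare_delta f g E" reads_first
      "\<lambda>s. s = Verdict True" "Both s t"]
  by (simp add: two_tape_accepts_compare)

lemma two_tape_regular_on_tape:
  fixes \<delta> :: "('s :: finite, 'c :: finite) counter_delta"
  shows "two_tape_regular {(u, v). counter_accepts \<delta> F s 0 u}"
    "two_tape_regular {(u, v). counter_accepts \<delta> F s 0 v}"
  unfolding two_tape_regular_def
  using is_two_tape_language_counter[of to_nat "on_tape_delta \<delta> F" isl "\<lambda>s. s = Inr True" "Inl s"]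
    is_two_tape_language_counter[of to_nat "on_tape_delta \<delta> F" "\<lambda>s. \<not> isl s" "\<lambda>s. s = Inr True" "Inl s"]
  by (simp_all add: two_tape_accepts_on_fst_tape two_tape_accepts_on_snd_tape)

lemma async_two_tape_pppI:
  fixes F :: "('c :: finite list \<times> 'c list) set set"
  assumes "finite F" "F \<noteq> {}" "\<And>R. R \<in> F \<Longrightarrow> two_tape_regular R"
  shows "async_two_tape_ppp (range (to_nat :: 'c \<Rightarrow> nat)) (map_prod (map to_nat) (map to_nat) ` \<Inter>F)"
proof -
  let ?h = "map_prod (map to_nat) (map to_nat) :: 'c list \<times> 'c list \<Rightarrow> _"
  have "inj ?h" by (intro prod.inj_map list.inj_map inj_to_nat)
  then have "?h ` \<Inter>F = \<Inter>((`) ?h ` F)"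
    using assms(2) image_INT[of ?h UNIV F "\<lambda>R. R"] by auto
  then show ?thesis
    unfolding async_two_tape_ppp_def using assms
    by (intro exI[of _ "(`) ?h ` F"]) (auto simp: two_tape_regular_def)
qed

lemma lamplighter_multiplier:
  "async_two_tape_ppp (range (to_nat :: letter \<Rightarrow> nat)) (map_prod (map to_nat) (map to_nat) `
     {(u, v). u \<in> normal_forms \<and> v \<in> normal_forms \<and> lval v = lval u \<otimes>\<^bsub>lamplighter\<^esub> gen d c})"
proof -
  let ?K = "{(u, v). u \<in> normal_forms}" and ?K' = "{(u, v). v \<in> normal_forms}"
  define A B C where "A = mealy_equal num_succ True num_id False (=)"
    and "B = mealy_equal right_tl False right_id () (\<lambda>_ _. True)"
    and "C = mealy_equal left_Cons (False, c) left_pad (False, False) (\<lambda>s t. snd s = snd t)"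
  note ABC = A_def B_def C_def
  have K: "two_tape_regular ?K" "two_tape_regular ?K'"
    using two_tape_regular_on_tape[of nf_delta nf_final Start] by (simp_all add: nf_accepts_iff)
  have reg: "two_tape_regular A" "two_tape_regular B" "two_tape_regular C"
    "two_tape_regular (A\<inverse>)" "two_tape_regular (B\<inverse>)" "two_tape_regular (C\<inverse>)"
    unfolding ABC converse_mealy_equal by (rule two_tape_regular_mealy_equal)+
  show ?thesis
  proof (cases d)
    case True
    have "{(u, v). u \<in> normal_forms \<and> v \<in> normal_forms \<and> lval v = lval u \<otimes>\<^bsub>lamplighter\<^esub> gen d c} =
        \<Inter>{?K, ?K', A, B, C}"
      using True by (auto simp: mult_gen_iff ABC)
    then show ?thesis
      using async_two_tape_pppI[of "{?K, ?K', A, B, C}"] K reg by auto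
  next
    case False
    have "{(u, v). u \<in> normal_forms \<and> v \<in> normal_forms \<and> lval v = lval u \<otimes>\<^bsub>lamplighter\<^esub> gen d c} =
        \<Inter>{?K, ?K', A\<inverse>, B\<inverse>, C\<inverse>}"
      using False by (auto simp: mult_gen_False_iff mult_gen_iff ABC)
    then show ?thesis
      using async_two_tape_pppI[of "{?K, ?K', A\<inverse>, B\<inverse>, C\<inverse>}"] K reg by auto
  qed
qed

text \<open>
  Transport along an injection turns the lamplighter group, whose elements involve functions, into a
  group of numbers.
\<close>

lemma iso_image_group: "h \<in> iso G (image_group h G)" if "inj_on h (carrier G)"
  using that by (auto simp: iso_def hom_def image_group_def bij_betw_def)

lemma (in group) group_image_group:
  assumes "inj_on h (carrier G)"
  shows "group (image_group h G)"
  using iso_imp_img_group[OF iso_image_group[OF assms]] by (simp add: image_group_def)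

text \<open>
  The names of the group elements and of the letters do not matter, so a structure may be described
  over a group on any type and with letters from any finite type.
\<close>

theorem parallel_poly_pushdown_image_group:
  fixes h :: "'g \<Rightarrow> 'h" and \<psi> :: "'c :: finite \<Rightarrow> 'g" and G (structure)
  assumes "group G" and h: "inj_on h (carrier G)"
    and \<psi>: "\<And>x. \<psi> x \<in> carrier G" and bij: "bij_betw (word_value G \<psi>) L (carrier G)"
    and lang: "parallel_poly_pushdown_language (range (to_nat :: 'c \<Rightarrow> nat)) (map to_nat ` L)"
    and mult: "\<And>x. async_two_tape_ppp (range (to_nat :: 'c \<Rightarrow> nat)) (map_prod (map to_nat) (map to_nat) `
         {(u, v). u \<in> L \<and> v \<in> L \<and> word_value G \<psi> v = word_value G \<psi> u \<otimes> \<psi> x})"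
  shows "parallel_poly_pushdown_group (image_group h G)"
proof -
  interpret group G by fact
  let ?H = "image_group h G" and ?A = "range (to_nat :: 'c \<Rightarrow> nat)"
  let ?e = "map to_nat :: 'c list \<Rightarrow> nat list"
  define \<phi> where "\<phi> = (\<lambda>n. h (\<psi> (from_nat n)))"
  have closed: "word_value G \<psi> w \<in> carrier G" for w
    by (rule word_value_closed[of \<psi>, OF \<psi>])
  have mult_H: "h a \<otimes>\<^bsub>?H\<^esub> h b = h (a \<otimes> b)" if "a \<in> carrier G" "b \<in> carrier G" for a b
    using that h by (simp add: image_group_def)
  have word_value_H: "word_value ?H \<phi> (?e w) = h (word_value G \<psi> w)" for w
  proof (induction w)
    case Nil
    show ?case by (simp add: word_value_def image_group_def)
  next
    case (Cons x w)
    then show ?case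
      using mult_H[OF \<psi> closed] by (simp add: word_value_def \<phi>_def)
  qed
  have word_value_snoc: "word_value ?H \<phi> (?e u @ [to_nat x]) = h (word_value G \<psi> u \<otimes> \<psi> x)" for u x
  proof -
    have "word_value G \<psi> [x] = \<psi> x" using \<psi> by (simp add: word_value_def)
    then show ?thesis
      using word_value_H[of "u @ [x]"] word_value_append[of \<psi>, OF \<psi>] by simp
  qed
  have "word_value ?H \<phi> ` lists ?A = carrier ?H"
  proof -
    have "word_value G \<psi> ` UNIV = carrier G"
      using bij_betw_imp_surj_on[OF bij] closed
      by (intro equalityI image_subsetI closed) (metis image_mono subset_UNIV)
    moreover have "word_value ?H \<phi> ` lists ?A = h ` word_value G \<psi> ` UNIV"
      unfolding lists_image lists_UNIV by (simp add: image_image word_value_H)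
    ultimately show ?thesis by (simp add: image_group_def)
  qed
  moreover have "\<phi> \<in> ?A \<rightarrow> carrier ?H"
    using \<psi> by (auto simp: \<phi>_def image_group_def)
  moreover have "ppp_structure ?H ?A \<phi> (?e ` L)"
    unfolding ppp_structure_def
  proof (intro conjI ballI lang)
    have "bij_betw (h \<circ> word_value G \<psi>) L (carrier ?H)"
      using bij h by (intro bij_betw_trans[OF bij]) (simp add: bij_betw_def image_group_def)
    moreover have "h \<circ> word_value G \<psi> = word_value ?H \<phi> \<circ> ?e"
      by (simp add: fun_eq_iff word_value_H)
    moreover have "bij_betw ?e L (?e ` L)"
      by (simp add: bij_betw_def inj_on_def inj_map_eq_map)
    ultimately show "bij_betw (word_value ?H \<phi>) (?e ` L) (carrier ?H)"
      by (simp add: bij_betw_comp_iff)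
    fix a assume "a \<in> ?A"
    then obtain x :: 'c where a: "a = to_nat x" by blast
    have "word_value ?H \<phi> (?e v) = word_value ?H \<phi> (?e u @ [a]) \<longleftrightarrow>
        word_value G \<psi> v = word_value G \<psi> u \<otimes> \<psi> x" for u v
      unfolding a word_value_H word_value_snoc
      by (rule inj_on_eq_iff[OF h closed m_closed[OF closed \<psi>]])
    then show "async_two_tape_ppp ?A {(w, w'). w \<in> ?e ` L \<and> w' \<in> ?e ` L \<and>
          word_value ?H \<phi> w' = word_value ?H \<phi> (w @ [a])}"
      using mult[of x] by (simp only: pairs_in_image)
  qed
  ultimately show ?thesis
    unfolding parallel_poly_pushdown_group_def using group_image_group[OF h]
    by (intro conjI exI[of _ ?A] exI[of _ \<phi>] exI[of _ "?e ` L"]) simp_all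
qed

lemma normal_forms_language:
  "parallel_poly_pushdown_language (range (to_nat :: letter \<Rightarrow> nat)) (map to_nat ` normal_forms)"
  unfolding parallel_poly_pushdown_language_def
  using is_dpda_language_counter[of "to_nat :: letter \<Rightarrow> nat" nf_delta nf_final Start]
  by (intro exI[of _ "{map to_nat ` normal_forms}"]) (simp add: nf_accepts_iff)

theorem corollary5p5:
  shows "\<exists>G :: nat monoid. parallel_poly_pushdown_group G \<and> \<not> finitely_presented G"
proof -
  let ?h = "to_nat_on (carrier lamplighter)"
  let ?H = "image_group ?h lamplighter"
  have h: "inj_on ?h (carrier lamplighter)"
    by (rule inj_on_to_nat_on[OF countable_lamplighter])
  have "parallel_poly_pushdown_group ?H"
  proof (rule parallel_poly_pushdown_image_group[OF group_lamplighter h letter_value_closed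
        bij_betw_normal_forms normal_forms_language])
    fix x
    obtain d c where "letter_value x = gen d c" by (cases x) auto
    then show "async_two_tape_ppp (range (to_nat :: letter \<Rightarrow> nat)) (map_prod (map to_nat) (map to_nat) `
        {(u, v). u \<in> normal_forms \<and> v \<in> normal_forms \<and>
           lval v = lval u \<otimes>\<^bsub>lamplighter\<^esub> letter_value x})"
      using lamplighter_multiplier by simp
  qed
  moreover have "\<not> finitely_presented ?H"
  proof
    have "lamplighter \<cong> ?H"
      using iso_image_group[OF h] by (auto simp: is_iso_def)
    moreover assume "finitely_presented ?H"
    ultimately have "finitely_presented lamplighter"
      unfolding finitely_presented_def using iso_trans by blast
    with lamplighter_not_finitely_presented show False by contradiction
  qed
  ultimately show ?thesis by blast
qed

end
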